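(* Let $(M,\varphi)$ and $(N,\psi)$ be Riemannian manifolds, with $M$ connected, compact and orientable, and let $T$ be a tensor on $M\times N$ of type $(1,1)$ all of whose components are null except $T^i_\alpha(a,x)$, $1\le i\le \dim N$, $1\le\alpha\le\dim M$. If the smooth map $f\in C^\infty(M,N)$ is a solution of the system of partial differential equations $\delta f=T$, that is, locally $$\frac{\partial f^i}{\partial a^\alpha}(a)=T^i_\alpha(a,f(a))\quad\text{for all } i,\alpha,$$ then $f$ is an extremal of the functional $$\mathcal L_T:C^\infty(M,N)\setminus\{f : \exists\, a\in M \text{ such that } \langle\delta f,T\rangle(a)=0\}\to\mathbb R_+,$$ $$\mathcal L_T(f)=\frac12\int_M\frac{\|\delta f\|^2\,\|T\|^2}{\langle\delta f,T\rangle^2}\sqrt{\varphi}\,da=\frac12\int_M\frac{\|T\|^2}{\langle\delta f,T\rangle^2}\,\varphi^{\alpha\beta}\psi_{ij}f^i_\alpha f^j_\beta\sqrt{\varphi}\,da .$$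
   Context: Local coordinates on $M$ are $(a^\alpha)$ and on $N$ are $(x^i)$; the summation convention is used. For $f\in C^\infty(M,N)$ write $f^i=x^i(f)$ and $f^i_\alpha=\partial f^i/\partial a^\alpha$. The map $f$ induces the section $\delta f=f^i_\alpha\, da^\alpha\otimes \frac{\partial}{\partial x^i}\big|_{f(a)}$ of $T^*M\otimes f^{-1}(TN)$. The tensor $T$ on $M\times N$ assigns to each $(a,x)\in M\times N$ an element $T^i_\alpha(a,x)\,da^\alpha\otimes\frac{\partial}{\partial x^i}$ of $T_a^*M\otimes T_xN$. Given $f$, it is evaluated along the graph of $f$, giving the section $T^i_\alpha(a,f(a))\,da^\alpha\otimes\frac{\partial}{\partial x^i}\big|_{f(a)}$ of $T^*M\otimes f^{-1}(TN)$, also denoted $T$. For sections $S,T$ of $T^*M\otimes f^{-1}(TN)$, the scalar product is the function on $M$ given by $\langle T,S\rangle(a)=\varphi^{\alpha\beta}(a)\,\psi_{ij}(f(a))\,T^i_\alpha S^j_\beta$, where $(\varphi^{\alpha\beta})$ is the inverse matrix of $(\varphi_{\alpha\beta})$, and $\|T\|^2=\langle T,T\rangle$. In the integrals, $\varphi=\det(\varphi_{\alpha\beta})$, so $\sqrt{\varphi}\,da$ is the Riemannian volume element of $(M,\varphi)$. "Extremal of $\mathcal L_T$" means a critical point of $\mathcal L_T$, i.e. a map satisfying the Euler-Lagrange equations of $\mathcal L_T$.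
   Formalization: The solution f is additionally assumed to lie in the domain of the functional, i.e. ⟨δf,T⟩ vanishes nowhere on M; otherwise (for instance T = 0 and f constant) the functional is not defined at f and the claim has no meaning. *)

theory Defs
  imports "HOL-Analysis.Analysis"
begin

section \<open>Smooth functions between Euclidean spaces\<close>

text \<open>Intended for open sets \<open>S\<close> only, where differentiability at a point does not depend on the
  values outside \<open>S\<close>.\<close>

primrec Ck_on ::
  "nat \<Rightarrow> 'a::real_normed_vector set \<Rightarrow> ('a \<Rightarrow> 'b::real_normed_vector) \<Rightarrow> bool" where
  "Ck_on 0 S f \<longleftrightarrow> continuous_on S f"
| "Ck_on (Suc k) S f \<longleftrightarrow>
     (\<forall>x\<in>S. f differentiable (at x)) \<and> (\<forall>v. Ck_on k S (\<lambda>x. frechet_derivative f (at x) v))"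

definition smooth_on ::
  "'a::real_normed_vector set \<Rightarrow> ('a \<Rightarrow> 'b::real_normed_vector) \<Rightarrow> bool" where
  "smooth_on S f \<longleftrightarrow> (\<forall>k. Ck_on k S f)"


section \<open>Smooth manifolds\<close>

text \<open>A chart is a coordinate domain together with its coordinate map. The dimension of a manifold
  is \<open>CARD('i)\<close>, so that \<open>'i\<close> is the type of coordinate indices. Atlases need not be maximal.\<close>

type_synonym ('a, 'i) chart = "'a set \<times> ('a \<Rightarrow> real ^ 'i)"

abbreviation chart_dom :: "('a, 'i::finite) chart \<Rightarrow> 'a set" where
  "chart_dom C \<equiv> fst C"

abbreviation coord :: "('a, 'i::finite) chart \<Rightarrow> 'a \<Rightarrow> real ^ 'i" where
  "coord C \<equiv> snd C"

abbreviation chart_inv :: "('a, 'i::finite) chart \<Rightarrow> real ^ 'i \<Rightarrow> 'a" where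
  "chart_inv C \<equiv> inv_into (chart_dom C) (coord C)"

definition is_chart :: "'a topology \<Rightarrow> ('a, 'i::finite) chart \<Rightarrow> bool" where
  "is_chart X C \<longleftrightarrow> openin X (chart_dom C) \<and> open (coord C ` chart_dom C) \<and>
     homeomorphic_map (subtopology X (chart_dom C)) (top_of_set (coord C ` chart_dom C)) (coord C)"

abbreviation transition ::
  "('a, 'i::finite) chart \<Rightarrow> ('a, 'i) chart \<Rightarrow> real ^ 'i \<Rightarrow> real ^ 'i" where
  "transition C D \<equiv> coord D \<circ> chart_inv C"

definition smooth_atlas :: "'a topology \<Rightarrow> ('a, 'i::finite) chart set \<Rightarrow> bool" where
  "smooth_atlas X A \<longleftrightarrow>
     (\<forall>C\<in>A. is_chart X C) \<and> (\<Union>C\<in>A. chart_dom C) = topspace X \<and>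
     (\<forall>C\<in>A. \<forall>D\<in>A. smooth_on (coord C ` (chart_dom C \<inter> chart_dom D)) (transition C D))"

definition smooth_manifold :: "'a topology \<Rightarrow> ('a, 'i::finite) chart set \<Rightarrow> bool" where
  "smooth_manifold X A \<longleftrightarrow> Hausdorff_space X \<and> second_countable X \<and> smooth_atlas X A"

definition orientable :: "'a topology \<Rightarrow> ('a, 'i::finite) chart set \<Rightarrow> bool" where
  "orientable X A \<longleftrightarrow> (\<exists>B. smooth_atlas X B \<and> smooth_atlas X (A \<union> B) \<and>
     (\<forall>C\<in>B. \<forall>D\<in>B. \<forall>a \<in> chart_dom C \<inter> chart_dom D.
        det (jacobian (transition C D) (at (coord C a))) > 0))"


section \<open>Riemannian manifolds\<close>

text \<open>Tensor fields are given classically: by their components in every chart, as functions of the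
  point, subject to the transformation law. Thus \<open>metric M C a $ \<alpha> $ \<beta>\<close> is the component with
  indices \<open>\<alpha>\<close>, \<open>\<beta>\<close> of the metric at the point \<open>a\<close> in the chart \<open>C\<close>.\<close>

record ('a, 'i) riem_mfd =
  mtop :: "'a topology"
  atlas :: "('a, 'i) chart set"
  metric :: "('a, 'i) chart \<Rightarrow> 'a \<Rightarrow> real ^ 'i ^ 'i"

definition riemannian_manifold :: "('a, 'i::finite) riem_mfd \<Rightarrow> bool" where
  "riemannian_manifold M \<longleftrightarrow>
     smooth_manifold (mtop M) (atlas M) \<and>
     (\<forall>C \<in> atlas M. smooth_on (coord C ` chart_dom C) (\<lambda>u. metric M C (chart_inv C u)) \<and>
        (\<forall>a \<in> chart_dom C. transpose (metric M C a) = metric M C a \<and>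
           (\<forall>v. v \<noteq> 0 \<longrightarrow> v \<bullet> (metric M C a *v v) > 0))) \<and>
     (\<forall>C \<in> atlas M. \<forall>D \<in> atlas M. \<forall>a \<in> chart_dom C \<inter> chart_dom D.
        let J = jacobian (transition C D) (at (coord C a))
        in metric M C a = transpose J ** metric M D a ** J)"

text \<open>The Riemannian volume. \<open>chart_vol\<close> is the volume of a Borel set inside a chart domain, i.e.
  the integral of the square root of the determinant of the metric over its coordinate image.
  By the change of variables formula it does not depend on the chart, and since countably many
  charts cover a manifold, the infimum below (over all countable covers of \<open>E\<close> by Borel
  pieces of charts) is the unique Borel measure that coincides with \<open>chart_vol M C\<close> on the Borel
  subsets of \<open>chart_dom C\<close>, for all charts \<open>C\<close>.\<close>

definition chart_vol :: "('a, 'i::finite) riem_mfd \<Rightarrow> ('a, 'i) chart \<Rightarrow> 'a set \<Rightarrow> ennreal" where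
  "chart_vol M C E =
     (\<integral>\<^sup>+ u \<in> coord C ` E. ennreal (sqrt (det (metric M C (chart_inv C u)))) \<partial>lborel)"

definition borel_sets :: "'a topology \<Rightarrow> 'a set set" where
  "borel_sets X = sigma_sets (topspace X) {U. openin X U}"

definition riem_vol :: "('a, 'i::finite) riem_mfd \<Rightarrow> 'a measure" where
  "riem_vol M = measure_of (topspace (mtop M)) {U. openin (mtop M) U}
     (\<lambda>E. INF (C, P) \<in> {(C :: nat \<Rightarrow> ('a, 'i) chart, P :: nat \<Rightarrow> 'a set).
              (\<forall>k. C k \<in> atlas M \<and> P k \<in> borel_sets (mtop M) \<and> P k \<subseteq> chart_dom (C k)) \<and>
              E \<subseteq> (\<Union>k. P k)}.
            \<Sum>k. chart_vol M (C k) (P k))"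


section \<open>Smooth maps, their differentials, and tensors along them\<close>

definition smooth_map ::
  "('a, 'm::finite) riem_mfd \<Rightarrow> ('b, 'n::finite) riem_mfd \<Rightarrow> ('a \<Rightarrow> 'b) \<Rightarrow> bool" where
  "smooth_map M N f \<longleftrightarrow> continuous_map (mtop M) (mtop N) f \<and>
     (\<forall>C \<in> atlas M. \<forall>D \<in> atlas N.
        smooth_on (coord C ` {a \<in> chart_dom C. f a \<in> chart_dom D}) (coord D \<circ> f \<circ> chart_inv C))"

text \<open>Elements of \<open>T\<^sub>a\<^sup>*M \<otimes> T\<^sub>xN\<close> are represented, in a chart \<open>C\<close> around \<open>a\<close> and a chart \<open>D\<close> around
  \<open>x\<close>, by matrices \<open>S\<close> where \<open>S $ i $ \<alpha>\<close> has the upper index \<open>i\<close> in \<open>N\<close> and the lower index \<open>\<alpha>\<close>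
  in \<open>M\<close>.\<close>

definition tensor_field ::
  "('a, 'm::finite) riem_mfd \<Rightarrow> ('b, 'n::finite) riem_mfd \<Rightarrow>
   (('a, 'm) chart \<Rightarrow> ('b, 'n) chart \<Rightarrow> 'a \<Rightarrow> 'b \<Rightarrow> real ^ 'm ^ 'n) \<Rightarrow> bool" where
  "tensor_field M N T \<longleftrightarrow>
     (\<forall>C \<in> atlas M. \<forall>D \<in> atlas N.
        smooth_on ((coord C ` chart_dom C) \<times> (coord D ` chart_dom D))
          (\<lambda>(u, v). T C D (chart_inv C u) (chart_inv D v))) \<and>
     (\<forall>C \<in> atlas M. \<forall>C' \<in> atlas M. \<forall>D \<in> atlas N. \<forall>D' \<in> atlas N.
      \<forall>a \<in> chart_dom C \<inter> chart_dom C'. \<forall>x \<in> chart_dom D \<inter> chart_dom D'.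
        T C' D' a x =
          jacobian (transition D D') (at (coord D x)) ** T C D a x **
          jacobian (transition C' C) (at (coord C' a)))"

definition differential ::
  "('a \<Rightarrow> 'b) \<Rightarrow> ('a, 'm::finite) chart \<Rightarrow> ('b, 'n::finite) chart \<Rightarrow> 'a \<Rightarrow> real ^ 'm ^ 'n" where
  "differential f C D a = jacobian (coord D \<circ> f \<circ> chart_inv C) (at (coord C a))"

definition along ::
  "(('a, 'm::finite) chart \<Rightarrow> ('b, 'n::finite) chart \<Rightarrow> 'a \<Rightarrow> 'b \<Rightarrow> real ^ 'm ^ 'n) \<Rightarrow>
   ('a \<Rightarrow> 'b) \<Rightarrow> ('a, 'm) chart \<Rightarrow> ('b, 'n) chart \<Rightarrow> 'a \<Rightarrow> real ^ 'm ^ 'n" where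
  "along T f C D a = T C D a (f a)"

definition tensor_inner ::
  "('a, 'm::finite) riem_mfd \<Rightarrow> ('b, 'n::finite) riem_mfd \<Rightarrow> ('a, 'm) chart \<Rightarrow> ('b, 'n) chart \<Rightarrow>
   'a \<Rightarrow> 'b \<Rightarrow> real ^ 'm ^ 'n \<Rightarrow> real ^ 'm ^ 'n \<Rightarrow> real" where
  "tensor_inner M N C D a x S T =
     (\<Sum>\<alpha>\<in>UNIV. \<Sum>\<beta>\<in>UNIV. \<Sum>i\<in>UNIV. \<Sum>j\<in>UNIV.
        matrix_inv (metric M C a) $ \<alpha> $ \<beta> * metric N D x $ i $ j * S $ i $ \<alpha> * T $ j $ \<beta>)"

text \<open>The scalar product of two sections along \<open>f\<close>; its value does not depend on the charts used to
  compute it, so any choice of charts around \<open>a\<close> and \<open>f a\<close> will do.\<close>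

definition chart_at :: "('a, 'i::finite) riem_mfd \<Rightarrow> 'a \<Rightarrow> ('a, 'i) chart" where
  "chart_at M a = (SOME C. C \<in> atlas M \<and> a \<in> chart_dom C)"

definition scalar_prod ::
  "('a, 'm::finite) riem_mfd \<Rightarrow> ('b, 'n::finite) riem_mfd \<Rightarrow> ('a \<Rightarrow> 'b) \<Rightarrow>
   (('a, 'm) chart \<Rightarrow> ('b, 'n) chart \<Rightarrow> 'a \<Rightarrow> real ^ 'm ^ 'n) \<Rightarrow>
   (('a, 'm) chart \<Rightarrow> ('b, 'n) chart \<Rightarrow> 'a \<Rightarrow> real ^ 'm ^ 'n) \<Rightarrow> 'a \<Rightarrow> real" where
  "scalar_prod M N f S T a =
     (let C = chart_at M a; D = chart_at N (f a)
      in tensor_inner M N C D a (f a) (S C D a) (T C D a))"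


section \<open>The functional and its extremals\<close>

definition LT_domain ::
  "('a, 'm::finite) riem_mfd \<Rightarrow> ('b, 'n::finite) riem_mfd \<Rightarrow>
   (('a, 'm) chart \<Rightarrow> ('b, 'n) chart \<Rightarrow> 'a \<Rightarrow> 'b \<Rightarrow> real ^ 'm ^ 'n) \<Rightarrow> ('a \<Rightarrow> 'b) set" where
  "LT_domain M N T = {f. smooth_map M N f} -
     {f. \<exists>a \<in> topspace (mtop M). scalar_prod M N f (differential f) (along T f) a = 0}"

definition LT ::
  "('a, 'm::finite) riem_mfd \<Rightarrow> ('b, 'n::finite) riem_mfd \<Rightarrow>
   (('a, 'm) chart \<Rightarrow> ('b, 'n) chart \<Rightarrow> 'a \<Rightarrow> 'b \<Rightarrow> real ^ 'm ^ 'n) \<Rightarrow> ('a \<Rightarrow> 'b) \<Rightarrow> real" where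
  "LT M N T f = 1 / 2 * (\<integral>a.
       scalar_prod M N f (differential f) (differential f) a *
       scalar_prod M N f (along T f) (along T f) a /
       (scalar_prod M N f (differential f) (along T f) a)\<^sup>2 \<partial>riem_vol M)"

definition smooth_variation ::
  "('a, 'm::finite) riem_mfd \<Rightarrow> ('b, 'n::finite) riem_mfd \<Rightarrow> ('a \<Rightarrow> 'b) \<Rightarrow>
   real \<Rightarrow> (real \<Rightarrow> 'a \<Rightarrow> 'b) \<Rightarrow> bool" where
  "smooth_variation M N f \<epsilon> F \<longleftrightarrow>
     \<epsilon> > 0 \<and> (\<forall>a \<in> topspace (mtop M). F 0 a = f a) \<and>
     continuous_map (prod_topology (top_of_set {-\<epsilon><..<\<epsilon>}) (mtop M)) (mtop N) (\<lambda>(t, a). F t a) \<and>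
     (\<forall>C \<in> atlas M. \<forall>D \<in> atlas N.
        smooth_on {(t, u). t \<in> {-\<epsilon><..<\<epsilon>} \<and> u \<in> coord C ` chart_dom C \<and>
                           F t (chart_inv C u) \<in> chart_dom D}
          (\<lambda>(t, u). coord D (F t (chart_inv C u))))"

text \<open>Variations need no support condition, since \<open>M\<close> is going to be compact.\<close>

definition critical_point ::
  "('a, 'm::finite) riem_mfd \<Rightarrow> ('b, 'n::finite) riem_mfd \<Rightarrow>
   ('a \<Rightarrow> 'b) set \<Rightarrow> (('a \<Rightarrow> 'b) \<Rightarrow> real) \<Rightarrow> ('a \<Rightarrow> 'b) \<Rightarrow> bool" where
  "critical_point M N \<D> \<L> f \<longleftrightarrow> f \<in> \<D> \<and>
     (\<forall>\<epsilon> F. smooth_variation M N f \<epsilon> F \<and> (\<forall>t \<in> {-\<epsilon><..<\<epsilon>}. F t \<in> \<D>) \<longrightarrow>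
        ((\<lambda>t. \<L> (F t)) has_real_derivative 0) (at 0))"

text \<open>The Lagrangian of \<open>LT\<close> in the charts \<open>C\<close>, \<open>D\<close>, as a function of the coordinates \<open>u\<close> on \<open>M\<close>,
  \<open>v\<close> on \<open>N\<close> and the first-order jet variable \<open>p\<close>, which stands for the derivatives of the map.\<close>

definition LT_lagrangian ::
  "('a, 'm::finite) riem_mfd \<Rightarrow> ('b, 'n::finite) riem_mfd \<Rightarrow>
   (('a, 'm) chart \<Rightarrow> ('b, 'n) chart \<Rightarrow> 'a \<Rightarrow> 'b \<Rightarrow> real ^ 'm ^ 'n) \<Rightarrow>
   ('a, 'm) chart \<Rightarrow> ('b, 'n) chart \<Rightarrow> real ^ 'm \<Rightarrow> real ^ 'n \<Rightarrow> real ^ 'm ^ 'n \<Rightarrow> real" where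
  "LT_lagrangian M N T C D u v p =
     (let a = chart_inv C u; x = chart_inv D v; \<tau> = T C D a x
      in 1 / 2 * (tensor_inner M N C D a x p p * tensor_inner M N C D a x \<tau> \<tau> /
                  (tensor_inner M N C D a x p \<tau>)\<^sup>2) * sqrt (det (metric M C a)))"

definition euler_lagrange ::
  "('a, 'm::finite) riem_mfd \<Rightarrow> ('b, 'n::finite) riem_mfd \<Rightarrow>
   (('a, 'm) chart \<Rightarrow> ('b, 'n) chart \<Rightarrow> real ^ 'm \<Rightarrow> real ^ 'n \<Rightarrow> real ^ 'm ^ 'n \<Rightarrow> real) \<Rightarrow>
   ('a \<Rightarrow> 'b) \<Rightarrow> bool" where
  "euler_lagrange M N \<Lambda> f \<longleftrightarrow>
     (\<forall>C \<in> atlas M. \<forall>D \<in> atlas N. \<forall>a \<in> chart_dom C. f a \<in> chart_dom D \<longrightarrow>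
       (let g = coord D \<circ> f \<circ> chart_inv C;
            Dg = (\<lambda>u. jacobian g (at u));
            dp = (\<lambda>i \<alpha> u. frechet_derivative (\<Lambda> C D u (g u)) (at (Dg u)) (axis i (axis \<alpha> 1)));
            dx = (\<lambda>i u. frechet_derivative (\<lambda>v. \<Lambda> C D u v (Dg u)) (at (g u)) (axis i 1))
        in \<forall>i. (\<Sum>\<alpha>\<in>UNIV. frechet_derivative (dp i \<alpha>) (at (coord C a)) (axis \<alpha> 1))
                = dx i (coord C a)))"

definition extremal_LT ::
  "('a, 'm::finite) riem_mfd \<Rightarrow> ('b, 'n::finite) riem_mfd \<Rightarrow>
   (('a, 'm) chart \<Rightarrow> ('b, 'n) chart \<Rightarrow> 'a \<Rightarrow> 'b \<Rightarrow> real ^ 'm ^ 'n) \<Rightarrow> ('a \<Rightarrow> 'b) \<Rightarrow> bool" where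
  "extremal_LT M N T f \<longleftrightarrow>
     critical_point M N (LT_domain M N T) (LT M N T) f \<and>
     euler_lagrange M N (LT_lagrangian M N T) f"

end

theory Submission
  imports Defs
begin

text \<open>By the Cauchy-Schwarz inequality for the scalar product on \<open>T\<^sup>*M \<otimes> TN\<close>, the ratio
  \<open>\<parallel>p\<parallel>\<^sup>2 \<parallel>\<tau>\<parallel>\<^sup>2 / \<langle>p, \<tau>\<rangle>\<^sup>2\<close> is at least \<open>1\<close>, with equality at \<open>p = \<tau>\<close>, and by Gram's identity it exceeds \<open>1\<close>
  by at most a constant times \<open>\<parallel>p - \<tau>\<parallel>\<^sup>2\<close>, locally uniformly. Along a variation of a solution of
  \<open>\<delta>f = T\<close> the difference \<open>p - \<tau>\<close> vanishes at time \<open>0\<close>, so the density deviates from \<open>1\<close> only by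
  \<open>O(t\<^sup>2)\<close>, uniformly on the compact manifold, and the derivative of the functional is \<open>0\<close>. In
  the Euler-Lagrange equations, the derivatives of the Lagrangian with respect to \<open>p\<close> and to \<open>x\<close>
  both vanish along a solution for the same reason.\<close>

section \<open>Positive definite matrices and the tensor product form\<close>

text \<open>Two difficulties shape the proof. The metric of \<open>N\<close> and the tensor vary
  with the point reached by a variation, so the comparison of the ratio with \<open>1\<close> must
  hold uniformly while all its ingredients move. It is therefore stated for matrices tending to
  limits along an arbitrary filter. Moreover no derivative is computed from the formula of the
  Lagrangian or under the integral sign: a function that stays within a multiple of the squared
  distance from its value at a point has derivative \<open>0\<close> there. The denominator is under
  control because along a solution \<open>\<langle>\<delta>f, T\<rangle>\<close> is the squared norm
  of \<open>T\<close>, which membership in \<open>LT_domain\<close> makes positive.\<close>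

definition tensor_form :: "real^'m^'m \<Rightarrow> real^'n^'n \<Rightarrow> real^'m^'n \<Rightarrow> real^'m^'n \<Rightarrow> real" where
  "tensor_form K H S T = (\<Sum>\<alpha>\<in>UNIV. \<Sum>\<beta>\<in>UNIV. \<Sum>i\<in>UNIV. \<Sum>j\<in>UNIV.
     K $ \<alpha> $ \<beta> * H $ i $ j * S $ i $ \<alpha> * T $ j $ \<beta>)"

lemma tensor_inner_eq_tensor_form:
  "tensor_inner M N C D a x = tensor_form (matrix_inv (metric M C a)) (metric N D x)"
  by (intro ext) (simp add: tensor_inner_def tensor_form_def)

lemma bilinear_tensor_form: "bilinear (tensor_form K H)"
  unfolding bilinear_def tensor_form_def
  by (auto intro!: linearI simp: algebra_simps sum.distrib sum_distrib_left)

definition posdef :: "real^'n^'n \<Rightarrow> bool" where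
  "posdef A \<longleftrightarrow> transpose A = A \<and> (\<forall>v. v \<noteq> 0 \<longrightarrow> v \<bullet> (A *v v) > 0)"

lemma posdef_nonneg: "posdef A \<Longrightarrow> v \<bullet> (A *v v) \<ge> 0"
  by (cases "v = 0") (auto simp: posdef_def less_imp_le)

lemma posdef_invertible:
  assumes "posdef A" shows "invertible A"
proof -
  have "\<forall>x. A *v x = 0 \<longrightarrow> x = 0"
    using assms unfolding posdef_def by (metis inner_zero_right less_irrefl)
  then show ?thesis
    using matrix_left_invertible_ker invertible_left_inverse by blast
qed

lemma matrix_inv_inverse:
  fixes A :: "real^'n^'n"
  assumes "invertible A" shows "A ** matrix_inv A = mat 1" "matrix_inv A ** A = mat 1"
  using someI_ex[OF assms[unfolded invertible_def]] by (simp_all add: matrix_inv_def)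

lemma matrix_inv_unique:
  fixes A :: "real^'n^'n"
  assumes "A ** B = mat 1" shows "matrix_inv A = B"
proof -
  have "invertible A"
    using assms by (meson invertible_right_inverse)
  then show ?thesis
    using assms by (metis matrix_inv_inverse(2) matrix_mul_assoc matrix_mul_lid matrix_mul_rid)
qed

lemma posdef_matrix_inv:
  assumes "posdef A" shows "posdef (matrix_inv A)"
proof -
  let ?B = "matrix_inv A"
  have i: "A ** ?B = mat 1" "?B ** A = mat 1"
    using assms posdef_invertible matrix_inv_inverse by blast+
  have "A ** transpose ?B = mat 1"
    using arg_cong[OF i(2), of transpose] assms
    by (simp add: matrix_transpose_mul posdef_def transpose_mat)
  then have "transpose ?B = ?B"
    by (metis matrix_inv_unique)
  moreover have "v \<bullet> (?B *v v) > 0" if "v \<noteq> 0" for v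
  proof -
    have "v = A *v (?B *v v)"
      by (simp add: matrix_vector_mul_assoc i)
    with that have "?B *v v \<noteq> 0" by auto
    then have "(?B *v v) \<bullet> (A *v (?B *v v)) > 0"
      using assms posdef_def by blast
    then show ?thesis
      by (simp add: matrix_vector_mul_assoc i inner_commute)
  qed
  ultimately show ?thesis by (auto simp: posdef_def)
qed

text \<open>This is how the inverse metric follows a change of coordinates with Jacobian
  \<open>A\<close>. With \<open>?K\<close> the inverse of the congruent matrix,
  \<open>?K ** transpose A ** G\<close> is a left inverse of the square matrix \<open>A\<close>,
  hence a right inverse, and regrouping the product exhibits the inverse of
  \<open>G\<close>.\<close>

lemma posdef_congruence:
  fixes A :: "real^'n^'n" and G :: "real^'n^'n"
  assumes "posdef G" "posdef (transpose A ** G ** A)"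
  shows "A ** matrix_inv (transpose A ** G ** A) ** transpose A = matrix_inv G"
proof -
  let ?K = "matrix_inv (transpose A ** G ** A)"
  have i: "?K ** (transpose A ** G ** A) = mat 1" "(transpose A ** G ** A) ** ?K = mat 1"
    using assms posdef_invertible matrix_inv_inverse by blast+
  have "(?K ** transpose A ** G) ** A = mat 1"
    using i by (simp add: matrix_mul_assoc)
  then have "A ** (?K ** transpose A ** G) = mat 1"
    using matrix_left_right_inverse by blast
  then have "(A ** ?K ** transpose A) ** G = mat 1"
    by (simp add: matrix_mul_assoc)
  then show ?thesis
    using matrix_inv_unique matrix_left_right_inverse by metis
qed

lemma trace_transpose_mult:
  fixes K X :: "real^'m^'m"
  shows "trace (transpose K ** X) = (\<Sum>\<alpha>\<in>UNIV. \<Sum>\<beta>\<in>UNIV. K $ \<alpha> $ \<beta> * X $ \<alpha> $ \<beta>)"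
  unfolding trace_def matrix_matrix_mult_def transpose_def
  by (simp add: sum.swap[of "\<lambda>\<alpha> \<beta>. K $ \<alpha> $ \<beta> * X $ \<alpha> $ \<beta>"])

lemma transpose_mult_mult_nth:
  fixes S T :: "real^'m^'n"
  shows "(transpose S ** (H ** T)) $ \<alpha> $ \<beta> = (\<Sum>i\<in>UNIV. \<Sum>j\<in>UNIV. H $ i $ j * S $ i $ \<alpha> * T $ j $ \<beta>)"
  by (simp add: matrix_matrix_mult_def transpose_def sum_distrib_left mult_ac)

text \<open>As a trace, the fourfold sum yields to matrix algebra: changes of coordinates and the
  symmetry of the form reduce to transposition and cyclicity of the trace.\<close>

lemma tensor_form_trace:
  "tensor_form K H S T = trace (transpose K ** transpose S ** H ** T)"
proof -
  have "trace (transpose K ** (transpose S ** (H ** T))) = tensor_form K H S T"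
    by (simp add: trace_transpose_mult transpose_mult_mult_nth tensor_form_def sum_distrib_left mult_ac)
  then show ?thesis by (simp add: matrix_mul_assoc)
qed

text \<open>Acting on both tensors amounts to acting on the two metrics. Under the trace,
  \<open>B\<close> already stands next to \<open>H\<close>; only the last factor \<open>A\<close>
  has to be rotated to the front to meet \<open>K\<close>.\<close>

lemma tensor_form_mult:
  "tensor_form K H (B ** S ** A) (B ** T ** A) =
   tensor_form (A ** K ** transpose A) (transpose B ** H ** B) S T"
proof -
  let ?X = "transpose K ** transpose A ** transpose S ** transpose B ** H ** B ** T"
  have "tensor_form K H (B ** S ** A) (B ** T ** A) = trace (?X ** A)"
    by (simp add: tensor_form_trace matrix_transpose_mul matrix_mul_assoc)
  also have "\<dots> = trace (A ** ?X)" by (rule trace_mul_sym)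
  also have "\<dots> = tensor_form (A ** K ** transpose A) (transpose B ** H ** B) S T"
    by (simp add: tensor_form_trace matrix_transpose_mul matrix_mul_assoc)
  finally show ?thesis .
qed

lemma tensor_form_sym:
  assumes "transpose K = K" "transpose H = H"
  shows "tensor_form K H S T = tensor_form K H T S"
proof -
  have "tensor_form K H S T = trace (transpose (transpose K ** (transpose S ** H ** T)))"
    by (simp add: tensor_form_trace matrix_mul_assoc) (simp add: trace_def transpose_def)
  also have "\<dots> = trace ((transpose T ** H ** S) ** K)"
    by (simp add: matrix_transpose_mul assms matrix_mul_assoc)
  also have "\<dots> = trace (K ** (transpose T ** H ** S))" by (rule trace_mul_sym)
  finally show ?thesis by (simp add: tensor_form_trace assms matrix_mul_assoc)
qed

text \<open>Induction on the index set, splitting off a rank-one matrix by a Schur complement of \<open>A\<close>.\<close>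

lemma sum_mult_nonneg_of_psd:
  fixes A B :: "'k \<Rightarrow> 'k \<Rightarrow> real"
  assumes "finite I"
    and "\<And>\<alpha> \<beta>. A \<alpha> \<beta> = A \<beta> \<alpha>"
    and "\<And>x. \<exists>\<alpha>\<in>I. x \<alpha> \<noteq> 0 \<Longrightarrow> (\<Sum>\<alpha>\<in>I. \<Sum>\<beta>\<in>I. x \<alpha> * x \<beta> * A \<alpha> \<beta>) > 0"
    and "\<And>x. (\<Sum>\<alpha>\<in>I. \<Sum>\<beta>\<in>I. x \<alpha> * x \<beta> * B \<alpha> \<beta>) \<ge> 0"
  shows "(\<Sum>\<alpha>\<in>I. \<Sum>\<beta>\<in>I. A \<alpha> \<beta> * B \<alpha> \<beta>) \<ge> 0"
  using assms
proof (induction I arbitrary: A rule: finite_induct)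
  case empty
  then show ?case by simp
next
  case (insert k I)
  have split: "(\<Sum>\<alpha>\<in>insert k I. \<Sum>\<beta>\<in>insert k I. f \<alpha> \<beta>) =
      f k k + (\<Sum>\<beta>\<in>I. f k \<beta>) + (\<Sum>\<alpha>\<in>I. f \<alpha> k) + (\<Sum>\<alpha>\<in>I. \<Sum>\<beta>\<in>I. f \<alpha> \<beta>)" for f :: "'k \<Rightarrow> 'k \<Rightarrow> real"
    using insert.hyps by (simp add: sum.distrib algebra_simps)
  define c where "c = A k k"
  have c: "c > 0"
  proof -
    have "0 < (\<Sum>\<alpha>\<in>insert k I. \<Sum>\<beta>\<in>insert k I. (if \<alpha> = k then 1 else 0) * (if \<beta> = k then 1 else 0) * A \<alpha> \<beta>)"
      by (rule insert.prems(2)) auto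
    also have "\<dots> = c"
      using insert.hyps by (simp add: c_def if_distrib[of "\<lambda>x. x * _"] sum.If_cases cong: if_cong)
    finally show ?thesis .
  qed
  define A' where "A' \<alpha> \<beta> = A \<alpha> \<beta> - A \<alpha> k * A \<beta> k / c" for \<alpha> \<beta>
  have A'_k: "A' k \<alpha> = 0" "A' \<alpha> k = 0" for \<alpha>
    using c insert.prems(1)[of k \<alpha>] by (simp_all add: A'_def flip: c_def)
  have "(\<Sum>\<alpha>\<in>I. \<Sum>\<beta>\<in>I. A' \<alpha> \<beta> * B \<alpha> \<beta>) \<ge> 0"
  proof (rule insert.IH)
    show "A' \<alpha> \<beta> = A' \<beta> \<alpha>" for \<alpha> \<beta>
      using insert.prems(1) by (simp add: A'_def mult.commute)
    show "(\<Sum>\<alpha>\<in>I. \<Sum>\<beta>\<in>I. x \<alpha> * x \<beta> * B \<alpha> \<beta>) \<ge> 0" for x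
    proof -
      let ?x = "\<lambda>\<alpha>. if \<alpha> = k then 0 else x \<alpha>"
      have "0 \<le> (\<Sum>\<alpha>\<in>insert k I. \<Sum>\<beta>\<in>insert k I. ?x \<alpha> * ?x \<beta> * B \<alpha> \<beta>)"
        by (rule insert.prems(3))
      also have "\<dots> = (\<Sum>\<alpha>\<in>I. \<Sum>\<beta>\<in>I. ?x \<alpha> * ?x \<beta> * B \<alpha> \<beta>)"
        by (simp add: split)
      also have "\<dots> = (\<Sum>\<alpha>\<in>I. \<Sum>\<beta>\<in>I. x \<alpha> * x \<beta> * B \<alpha> \<beta>)"
        using insert.hyps by (intro sum.cong refl) auto
      finally show ?thesis .
    qed
    show "(\<Sum>\<alpha>\<in>I. \<Sum>\<beta>\<in>I. x \<alpha> * x \<beta> * A' \<alpha> \<beta>) > 0" if "\<exists>\<alpha>\<in>I. x \<alpha> \<noteq> 0" for x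
    proof -
      define b where "b = (\<Sum>\<beta>\<in>I. A \<beta> k * x \<beta>)"
      \<comment> \<open>\<open>- b / c\<close> minimises the quadratic form of \<open>A\<close> over
        the coordinate \<open>k\<close>. The minimum is the form of the Schur complement
        \<open>A'\<close> at \<open>x\<close>, so positivity passes from \<open>A\<close> to
        \<open>A'\<close>.\<close>
      define y where "y \<alpha> = (if \<alpha> = k then - b / c else x \<alpha>)" for \<alpha>
      have yI: "y \<alpha> = x \<alpha>" if "\<alpha> \<in> I" for \<alpha>
        using that insert.hyps by (auto simp: y_def)
      have bb: "b * b = (\<Sum>\<alpha>\<in>I. \<Sum>\<beta>\<in>I. x \<alpha> * x \<beta> * (A \<alpha> k * A \<beta> k))"
        unfolding b_def by (simp add: sum_product mult_ac)
      have "0 < (\<Sum>\<alpha>\<in>insert k I. \<Sum>\<beta>\<in>insert k I. y \<alpha> * y \<beta> * A \<alpha> \<beta>)"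
        using that insert.hyps by (intro insert.prems(2)) (auto simp: y_def)
      also have "\<dots> = y k * y k * c + y k * b + y k * b + (\<Sum>\<alpha>\<in>I. \<Sum>\<beta>\<in>I. x \<alpha> * x \<beta> * A \<alpha> \<beta>)"
        unfolding split b_def sum_distrib_left c_def
        by (intro arg_cong2[of _ _ _ _ "(+)"] sum.cong refl)
          (auto simp: yI insert.prems(1)[of k])
      also have "\<dots> = - (b * b) / c + (\<Sum>\<alpha>\<in>I. \<Sum>\<beta>\<in>I. x \<alpha> * x \<beta> * A \<alpha> \<beta>)"
        using c by (simp add: y_def field_simps)
      also have "\<dots> = (\<Sum>\<alpha>\<in>I. \<Sum>\<beta>\<in>I. x \<alpha> * x \<beta> * A' \<alpha> \<beta>)"
        unfolding bb A'_def
        by (simp add: sum_divide_distrib sum_negf sum_subtractf right_diff_distrib)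
      finally show ?thesis .
    qed
  qed
  also have "(\<Sum>\<alpha>\<in>I. \<Sum>\<beta>\<in>I. A' \<alpha> \<beta> * B \<alpha> \<beta>) = (\<Sum>\<alpha>\<in>insert k I. \<Sum>\<beta>\<in>insert k I. A' \<alpha> \<beta> * B \<alpha> \<beta>)"
    by (simp add: split A'_k)
  also have "\<dots> = (\<Sum>\<alpha>\<in>insert k I. \<Sum>\<beta>\<in>insert k I. A \<alpha> \<beta> * B \<alpha> \<beta>) -
      (\<Sum>\<alpha>\<in>insert k I. \<Sum>\<beta>\<in>insert k I. A \<alpha> k * A \<beta> k * B \<alpha> \<beta>) / c"
    unfolding A'_def sum_divide_distrib by (simp only: flip: sum_subtractf) (simp add: left_diff_distrib)
  \<comment> \<open>The rank-one part that was split off contributes the form of \<open>B\<close> at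
    column \<open>k\<close> of \<open>A\<close>, divided by the positive pivot
    \<open>c\<close>.\<close>
  finally show ?case
    using insert.prems(3)[of "\<lambda>\<alpha>. A \<alpha> k"] c by (smt (verit) divide_nonneg_pos)
qed

lemma quadratic_form_sum:
  fixes A :: "real^'n^'n"
  shows "v \<bullet> (A *v v) = (\<Sum>i\<in>UNIV. \<Sum>j\<in>UNIV. v $ i * v $ j * A $ i $ j)"
  by (simp add: inner_vec_def matrix_vector_mult_def sum_distrib_left mult_ac)

text \<open>The form is the entrywise pairing of \<open>K\<close> with
  \<open>transpose S ** (H ** S)\<close>. The latter is positive semidefinite, since its quadratic
  form at \<open>x\<close> is that of \<open>H\<close> at the image of \<open>x\<close> under
  \<open>S\<close>.\<close>

lemma tensor_form_nonneg:
  fixes K :: "real^'m^'m" and H :: "real^'n^'n"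
  assumes K: "posdef K" and H: "posdef H"
  shows "tensor_form K H S S \<ge> 0"
proof -
  define B where "B \<alpha> \<beta> = (\<Sum>i\<in>UNIV. \<Sum>j\<in>UNIV. H $ i $ j * S $ i $ \<alpha> * S $ j $ \<beta>)" for \<alpha> \<beta>
  have "(\<Sum>\<alpha>\<in>UNIV. \<Sum>\<beta>\<in>UNIV. K $ \<alpha> $ \<beta> * B \<alpha> \<beta>) \<ge> 0"
  proof (rule sum_mult_nonneg_of_psd)
    show "K $ \<alpha> $ \<beta> = K $ \<beta> $ \<alpha>" for \<alpha> \<beta>
    proof -
      have "transpose K $ \<alpha> $ \<beta> = K $ \<alpha> $ \<beta>"
        using K by (simp add: posdef_def)
      then show ?thesis by (simp add: transpose_def)
    qed
    show "(\<Sum>\<alpha>\<in>UNIV. \<Sum>\<beta>\<in>UNIV. x \<alpha> * x \<beta> * K $ \<alpha> $ \<beta>) > 0" if "\<exists>\<alpha>\<in>UNIV. x \<alpha> \<noteq> 0" for x :: "'m \<Rightarrow> real"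
    proof -
      have "vec_lambda x \<noteq> 0" using that by (auto simp: vec_eq_iff)
      then have "vec_lambda x \<bullet> (K *v vec_lambda x) > 0" using K posdef_def by blast
      then show ?thesis by (simp add: quadratic_form_sum)
    qed
    show "(\<Sum>\<alpha>\<in>UNIV. \<Sum>\<beta>\<in>UNIV. x \<alpha> * x \<beta> * B \<alpha> \<beta>) \<ge> 0" for x
    proof -
      have "0 \<le> (S *v vec_lambda x) \<bullet> (H *v (S *v vec_lambda x))"
        by (rule posdef_nonneg[OF H])
      also have "\<dots> = vec_lambda x \<bullet> ((transpose S ** (H ** S)) *v vec_lambda x)"
        by (metis dot_lmul_matrix inner_commute matrix_vector_mul_assoc transpose_matrix_vector)
      also have "\<dots> = (\<Sum>\<alpha>\<in>UNIV. \<Sum>\<beta>\<in>UNIV. x \<alpha> * x \<beta> * B \<alpha> \<beta>)"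
        by (simp add: quadratic_form_sum B_def transpose_mult_mult_nth)
      finally show ?thesis .
    qed
  qed simp
  then show ?thesis
    by (simp add: tensor_form_def B_def sum_distrib_left mult_ac)
qed

section \<open>The ratio in the Lagrangian near its minimum\<close>

lemma tendsto_tensor_form [tendsto_intros]:
  assumes "(K \<longlongrightarrow> K0) F" "(H \<longlongrightarrow> H0) F" "(S \<longlongrightarrow> S0) F" "(T \<longlongrightarrow> T0) F"
  shows "((\<lambda>z. tensor_form (K z) (H z) (S z) (T z)) \<longlongrightarrow> tensor_form K0 H0 S0 T0) F"
  unfolding tensor_form_def by (intro tendsto_intros assms)

lemma tendsto_det [tendsto_intros]:
  fixes A :: "'z \<Rightarrow> real^'n^'n"
  assumes "(A \<longlongrightarrow> A0) F"
  shows "((\<lambda>z. det (A z)) \<longlongrightarrow> det A0) F"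
  unfolding det_def by (intro tendsto_intros assms)

text \<open>Cramer's rule writes the inverse through quotients of determinants, which are
  polynomials in the entries. \<open>R\<close> is that formula; it agrees with
  \<open>matrix_inv\<close> where the determinant is nonzero, which holds eventually because the
  limit is invertible.\<close>

lemma tendsto_matrix_inv:
  fixes A :: "'z \<Rightarrow> real^'n^'n"
  assumes A: "(A \<longlongrightarrow> A0) F" and "invertible A0"
  shows "((\<lambda>z. matrix_inv (A z)) \<longlongrightarrow> matrix_inv A0) F"
proof -
  define R where "R A = (\<chi> k l. det (\<chi> i j. if j = k then axis l 1 $ i else A $ i $ j) / det A)"
    for A :: "real^'n^'n"
  have R: "matrix_inv A = R A" if "det A \<noteq> 0" for A :: "real^'n^'n"
  proof -
    have "invertible A" using that invertible_det_nz by blast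
    then have "A *v (matrix_inv A *v axis l 1) = axis l 1" for l
      by (simp add: matrix_vector_mul_assoc matrix_inv_inverse)
    then have "matrix_inv A *v axis l 1 =
        (\<chi> k. det (\<chi> i j. if j = k then axis l 1 $ i else A $ i $ j) / det A)" for l
      using cramer[OF that] by blast
    then have "column l (matrix_inv A) =
        (\<chi> k. det (\<chi> i j. if j = k then axis l 1 $ i else A $ i $ j) / det A)" for l
      by (simp add: matrix_vector_mult_basis)
    then show ?thesis
      by (simp add: vec_eq_iff column_def R_def)
  qed
  have d: "det A0 \<noteq> 0" using assms(2) invertible_det_nz by blast
  have "eventually (\<lambda>z. det (A z) \<noteq> 0) F"
    using tendsto_det[OF A] d by (rule tendsto_imp_eventually_ne)
  then have ev: "eventually (\<lambda>z. R (A z) = matrix_inv (A z)) F"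
    by eventually_elim (simp add: R)
  have "((\<lambda>z. if b then c else A z $ i $ j) \<longlongrightarrow> (if b then c else A0 $ i $ j)) F" for b c i j
    using A by (auto intro!: tendsto_intros)
  then have "((\<lambda>z. R (A z)) \<longlongrightarrow> R A0) F"
    unfolding R_def by (intro tendsto_intros A d)
  then show ?thesis
    using ev d by (simp add: R tendsto_cong)
qed

text \<open>The factor in front of the norms is an explicit continuous function of \<open>K\<close>
  and \<open>H\<close>. It stays bounded when the metrics vary near a limit, which makes the later
  estimates locally uniform.\<close>

lemma abs_tensor_form_le:
  "\<bar>tensor_form K H S T\<bar> \<le>
    (\<Sum>\<alpha>\<in>UNIV. \<Sum>\<beta>\<in>UNIV. \<Sum>i\<in>UNIV. \<Sum>j\<in>UNIV. \<bar>K $ \<alpha> $ \<beta>\<bar> * \<bar>H $ i $ j\<bar>) * norm S * norm T"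
proof -
  have "\<bar>A $ i $ \<alpha>\<bar> \<le> norm A" for A :: "real^'a^'b" and i \<alpha>
    by (rule order_trans[OF component_le_norm_cart Finite_Cartesian_Product.norm_nth_le])
  then show ?thesis
    unfolding tensor_form_def sum_distrib_right
    by (intro order_trans[OF sum_abs] sum_mono) (auto simp: abs_mult intro!: mult_mono)
qed

text \<open>The Lagrangian without \<open>1 / 2\<close> and the volume factor. The points of the two
  manifolds enter only through the matrix arguments.\<close>

definition tensor_ratio :: "real^'m^'m \<Rightarrow> real^'n^'n \<Rightarrow> real^'m^'n \<Rightarrow> real^'m^'n \<Rightarrow> real" where
  "tensor_ratio K H p \<tau> = tensor_form K H p p * tensor_form K H \<tau> \<tau> / (tensor_form K H p \<tau>)\<^sup>2"

text \<open>\<open>t *\<^sub>R p - c *\<^sub>R \<tau>\<close> is \<open>t\<close> times the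
  component of \<open>p\<close> orthogonal to \<open>\<tau>\<close>. Its square is \<open>t\<close>
  times the defect of the inequality, and \<open>t\<close> is positive.\<close>

lemma tensor_form_cauchy_schwarz:
  assumes "posdef K" "posdef H" "tensor_form K H \<tau> \<tau> > 0"
  shows "(tensor_form K H p \<tau>)\<^sup>2 \<le> tensor_form K H p p * tensor_form K H \<tau> \<tau>"
proof -
  interpret bounded_bilinear "tensor_form K H"
    using bilinear_tensor_form bilinear_conv_bounded_bilinear by blast
  define t c where "t = tensor_form K H \<tau> \<tau>" and "c = tensor_form K H p \<tau>"
  have "tensor_form K H \<tau> p = c"
    using assms by (simp add: c_def posdef_def tensor_form_sym)
  then have "tensor_form K H (t *\<^sub>R p - c *\<^sub>R \<tau>) (t *\<^sub>R p - c *\<^sub>R \<tau>) = t * (tensor_form K H p p * t - c\<^sup>2)"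
    by (simp add: diff_left diff_right scaleR_left scaleR_right flip: t_def c_def)
      (simp add: power2_eq_square algebra_simps)
  moreover have "tensor_form K H (t *\<^sub>R p - c *\<^sub>R \<tau>) (t *\<^sub>R p - c *\<^sub>R \<tau>) \<ge> 0"
    using assms by (intro tensor_form_nonneg)
  ultimately show ?thesis
    using assms(3) by (simp add: zero_le_mult_iff flip: t_def c_def)
qed

text \<open>A Gram determinant is unchanged when one vector is subtracted from the other. Read this
  way, the defect in the Cauchy-Schwarz inequality is quadratic in
  \<open>p - \<tau>\<close>.\<close>

lemma tensor_form_gram_diff:
  assumes "posdef K" "posdef H"
  shows "tensor_form K H p p * tensor_form K H \<tau> \<tau> - (tensor_form K H p \<tau>)\<^sup>2 =
    tensor_form K H (p - \<tau>) (p - \<tau>) * tensor_form K H \<tau> \<tau> - (tensor_form K H (p - \<tau>) \<tau>)\<^sup>2"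
proof -
  interpret bounded_bilinear "tensor_form K H"
    using bilinear_tensor_form bilinear_conv_bounded_bilinear by blast
  have "tensor_form K H \<tau> p = tensor_form K H p \<tau>"
    using assms by (simp add: posdef_def tensor_form_sym)
  then show ?thesis
    by (simp add: diff_left diff_right) (simp add: power2_eq_square algebra_simps)
qed

text \<open>Since \<open>p\<close> and \<open>\<tau>\<close> have the same limit, the denominator
  tends to the square of a positive number. The excess over \<open>1\<close> is the Gram determinant
  divided by that denominator: Cauchy-Schwarz bounds it from below, and dropping the square
  subtracted in Gram's identity bounds it from above. The free filter lets the estimate serve points
  of time and space, the jet variable and the target coordinates alike.\<close>

lemma tensor_ratio_quadratic:
  assumes "(K \<longlongrightarrow> K0) F" "(H \<longlongrightarrow> H0) F" "(p \<longlongrightarrow> \<tau>0) F" "(\<tau> \<longlongrightarrow> \<tau>0) F"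
    and "eventually (\<lambda>z. posdef (K z) \<and> posdef (H z)) F"
    and c: "tensor_form K0 H0 \<tau>0 \<tau>0 > 0"
  obtains B where "B > 0" "eventually (\<lambda>z. 1 \<le> tensor_ratio (K z) (H z) (p z) (\<tau> z) \<and>
      tensor_ratio (K z) (H z) (p z) (\<tau> z) \<le> 1 + B * (norm (p z - \<tau> z))\<^sup>2) F"
proof -
  define s where "s K H = (\<Sum>\<alpha>\<in>UNIV. \<Sum>\<beta>\<in>UNIV. \<Sum>i\<in>UNIV. \<Sum>j\<in>UNIV. \<bar>K $ \<alpha> $ \<beta>\<bar> * \<bar>H $ i $ j\<bar>)"
    for K :: "real^'b^'b" and H :: "real^'c^'c"
  have s0: "s K H \<ge> 0" for K H by (simp add: s_def sum_nonneg)
  \<comment> \<open>\<open>g\<close> is the coefficient that will multiply the squared norm of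
    \<open>p - \<tau>\<close>. It converges to \<open>g0\<close>, so \<open>g0 + 1\<close> bounds it
    eventually.\<close>
  define g where "g z = s (K z) (H z) * (tensor_form (K z) (H z) (\<tau> z) (\<tau> z) / (tensor_form (K z) (H z) (p z) (\<tau> z))\<^sup>2)" for z
  define g0 where "g0 = s K0 H0 * (tensor_form K0 H0 \<tau>0 \<tau>0 / (tensor_form K0 H0 \<tau>0 \<tau>0)\<^sup>2)"
  have "(g \<longlongrightarrow> g0) F"
    unfolding g_def g0_def s_def using c by (intro tendsto_intros assms) auto
  then have 1: "eventually (\<lambda>z. g z < g0 + 1) F"
    by (rule order_tendstoD) simp
  have 2: "eventually (\<lambda>z. tensor_form (K z) (H z) (\<tau> z) (\<tau> z) > 0) F"
    by (rule order_tendstoD(1)[OF tendsto_tensor_form[OF assms(1,2,4,4)] c])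
  have 3: "eventually (\<lambda>z. tensor_form (K z) (H z) (p z) (\<tau> z) > 0) F"
    by (rule order_tendstoD(1)[OF tendsto_tensor_form[OF assms(1-4)] c])
  have "g0 \<ge> 0" using c s0 by (simp add: g0_def)
  show ?thesis
  proof
    show "g0 + 1 > 0" using \<open>g0 \<ge> 0\<close> by simp
    show "eventually (\<lambda>z. 1 \<le> tensor_ratio (K z) (H z) (p z) (\<tau> z) \<and>
      tensor_ratio (K z) (H z) (p z) (\<tau> z) \<le> 1 + (g0 + 1) * (norm (p z - \<tau> z))\<^sup>2) F"
      using 1 2 3 assms(5)
    proof eventually_elim
      case (elim z)
      define tt where "tt = tensor_form (K z) (H z) (\<tau> z) (\<tau> z)"
      define pt where "pt = tensor_form (K z) (H z) (p z) (\<tau> z)"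
      define ww where "ww = tensor_form (K z) (H z) (p z - \<tau> z) (p z - \<tau> z)"
      have pos: "tt > 0" "pt > 0" using elim by (simp_all add: tt_def pt_def)
      have eq: "tensor_ratio (K z) (H z) (p z) (\<tau> z) = 1 +
          (tensor_form (K z) (H z) (p z) (p z) * tt - pt\<^sup>2) / pt\<^sup>2"
        using pos by (simp add: tensor_ratio_def field_simps flip: tt_def pt_def)
      have "pt\<^sup>2 \<le> tensor_form (K z) (H z) (p z) (p z) * tt"
        using elim unfolding tt_def pt_def by (intro tensor_form_cauchy_schwarz) auto
      then have lower: "1 \<le> tensor_ratio (K z) (H z) (p z) (\<tau> z)"
        unfolding eq by simp
      have "ww \<le> s (K z) (H z) * (norm (p z - \<tau> z))\<^sup>2"
        using abs_tensor_form_le[of "K z" "H z" "p z - \<tau> z" "p z - \<tau> z"]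
        by (simp add: ww_def s_def power2_eq_square mult.assoc)
      then have "ww * (tt / pt\<^sup>2) \<le> s (K z) (H z) * (norm (p z - \<tau> z))\<^sup>2 * (tt / pt\<^sup>2)"
        using pos by (intro mult_right_mono) auto
      also have "\<dots> = g z * (norm (p z - \<tau> z))\<^sup>2"
        by (simp add: g_def tt_def pt_def)
      also have "\<dots> \<le> (g0 + 1) * (norm (p z - \<tau> z))\<^sup>2"
        using elim by (intro mult_right_mono) auto
      finally have "ww * tt / pt\<^sup>2 \<le> (g0 + 1) * (norm (p z - \<tau> z))\<^sup>2" by simp
      moreover have "(tensor_form (K z) (H z) (p z) (p z) * tt - pt\<^sup>2) / pt\<^sup>2 \<le> ww * tt / pt\<^sup>2"
        using elim tensor_form_gram_diff[of "K z" "H z" "p z" "\<tau> z"]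
        by (intro divide_right_mono) (auto simp: tt_def pt_def ww_def)
      ultimately show ?case using lower unfolding eq by simp
    qed
  qed
qed

text \<open>The difference quotient is at most \<open>B * norm (y - x)\<close>. Differentiability is
  a conclusion here, so the functional along a variation and the Lagrangian are both differentiated
  by estimates alone.\<close>

lemma has_derivative_zero_of_quadratic:
  fixes f :: "'a::real_normed_vector \<Rightarrow> real"
  assumes "eventually (\<lambda>y. \<bar>f y - f x\<bar> \<le> B * (norm (y - x))\<^sup>2) (nhds x)"
  shows "(f has_derivative (\<lambda>_. 0)) (at x)"
proof -
  have "((\<lambda>y. B * norm (y - x)) \<longlongrightarrow> B * norm (x - x)) (at x)"
    by (intro tendsto_intros)
  then have lim: "((\<lambda>y. B * norm (y - x)) \<longlongrightarrow> 0) (at x)" by simp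
  have "eventually (\<lambda>y. \<bar>f y - f x\<bar> \<le> B * (norm (y - x))\<^sup>2) (at x)"
    using assms by (simp add: eventually_at_filter eventually_mono)
  then have "((\<lambda>y. (f y - f x) /\<^sub>R norm (y - x)) \<longlongrightarrow> 0) (at x)"
  proof (intro Lim_null_comparison[OF _ lim], eventually_elim)
    case (elim y)
    then show ?case
      by (cases "y = x") (auto simp: field_simps power2_eq_square abs_mult)
  qed
  then show ?thesis
    by (simp add: has_derivative_at_within divide_inverse mult.commute)
qed

section \<open>Calculus of smooth maps: continuity, Lipschitz bounds, Jacobians\<close>

lemma smooth_on_differentiable: "smooth_on S f \<Longrightarrow> x \<in> S \<Longrightarrow> f differentiable (at x)"
  unfolding smooth_on_def using Ck_on.simps(2)[of 0 S f] by blast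

lemma smooth_on_frechet_derivative:
  "smooth_on S f \<Longrightarrow> smooth_on S (\<lambda>x. frechet_derivative f (at x) v)"
  unfolding smooth_on_def using Ck_on.simps(2)[of _ S f] by blast

lemma smooth_on_tendsto:
  "smooth_on S f \<Longrightarrow> x \<in> S \<Longrightarrow> (f \<longlongrightarrow> f x) (nhds x)"
  using differentiable_imp_continuous_within[OF smooth_on_differentiable, of S f x]
  by (simp add: isCont_def tendsto_at_iff_tendsto_nhds)

text \<open>A mean value estimate on a convex ball. Smoothness gives continuity of the derivative in
  each fixed direction; the sum \<open>G\<close> over the basis directions is continuous and bounds
  the operator norm, and it stays below \<open>G x + 1\<close> near \<open>x\<close>.\<close>

lemma smooth_on_lipschitz_ball:
  fixes f :: "'a::euclidean_space \<Rightarrow> 'b::real_normed_vector"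
  assumes "open S" "smooth_on S f" "x \<in> S"
  obtains r L where "r > 0" "L > 0" "ball x r \<subseteq> S"
    "\<And>y z. y \<in> ball x r \<Longrightarrow> z \<in> ball x r \<Longrightarrow> norm (f y - f z) \<le> L * norm (y - z)"
proof -
  define G where "G y = (\<Sum>b\<in>Basis. norm (frechet_derivative f (at y) b))" for y
  have "(G \<longlongrightarrow> G x) (nhds x)"
    unfolding G_def using assms
    by (intro tendsto_intros smooth_on_tendsto[OF smooth_on_frechet_derivative])
  then have "eventually (\<lambda>y. G y < G x + 1) (nhds x)"
    by (rule order_tendstoD) simp
  moreover have "eventually (\<lambda>y. y \<in> S) (nhds x)"
    using assms eventually_nhds by blast
  ultimately have "eventually (\<lambda>y. y \<in> S \<and> G y < G x + 1) (nhds x)"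
    by eventually_elim simp
  then obtain r where r: "r > 0" "\<And>y. dist y x < r \<Longrightarrow> y \<in> S \<and> G y < G x + 1"
    by (auto simp: eventually_nhds_metric)
  then have rb: "y \<in> S \<and> G y \<le> G x + 1" if "y \<in> ball x r" for y
    using that by (simp add: dist_commute less_imp_le)
  show ?thesis
  proof
    show "r > 0" "ball x r \<subseteq> S" using r rb by auto
    show "G x + 1 > 0" by (simp add: G_def add_nonneg_pos sum_nonneg)
    show "norm (f y - f z) \<le> (G x + 1) * norm (y - z)" if "y \<in> ball x r" "z \<in> ball x r" for y z
    proof (rule differentiable_bound[of "ball x r" f "\<lambda>y. frechet_derivative f (at y)"])
      fix y assume y: "y \<in> ball x r"
      have d: "(f has_derivative frechet_derivative f (at y)) (at y)"
        using y rb assms smooth_on_differentiable frechet_derivative_works by blast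
      then show "(f has_derivative frechet_derivative f (at y)) (at y within ball x r)"
        by (rule has_derivative_at_withinI)
      show "onorm (frechet_derivative f (at y)) \<le> G x + 1"
        using onorm_componentwise[OF has_derivative_bounded_linear[OF d]] rb[OF y]
        by (simp add: G_def)
    qed (use that in auto)
  qed
qed

lemma tendsto_jacobian:
  fixes f :: "real^'m \<Rightarrow> real^'n"
  assumes "smooth_on S f" "x \<in> S"
  shows "((\<lambda>u. jacobian f (at u)) \<longlongrightarrow> jacobian f (at x)) (nhds x)"
  unfolding jacobian_def matrix_def
  by (intro tendsto_intros smooth_on_tendsto[OF smooth_on_frechet_derivative[OF assms(1)] assms(2)])

lemma jacobian_eqI:
  fixes f :: "real^'m \<Rightarrow> real^'n"
  shows "(f has_derivative (\<lambda>h. J *v h)) (at x) \<Longrightarrow> jacobian f (at x) = J"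
  by (simp add: jacobian_def matrix_of_matrix_vector_mul flip: frechet_derivative_at)

section \<open>Charts and the density of the functional\<close>

lemma chart_inv_coord: "is_chart X C \<Longrightarrow> a \<in> chart_dom C \<Longrightarrow> chart_inv C (coord C a) = a"
proof -
  assume C: "is_chart X C" and a: "a \<in> chart_dom C"
  have "inj_on (coord C) (topspace (subtopology X (chart_dom C)))"
    using C by (auto simp: is_chart_def dest: homeomorphic_imp_injective_map)
  moreover have "chart_dom C \<subseteq> topspace X"
    using C by (simp add: is_chart_def openin_subset)
  ultimately show ?thesis
    using a by (simp add: Int_absorb1)
qed

lemma chart_dom_subset: "is_chart X C \<Longrightarrow> chart_dom C \<subseteq> topspace X"
  by (simp add: is_chart_def openin_subset)

lemma chart_open_image:
  assumes "is_chart X C" "openin X U" "U \<subseteq> chart_dom C"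
  shows "open (coord C ` U)"
proof -
  have "openin (top_of_set (coord C ` chart_dom C)) (coord C ` U)"
    using assms homeomorphic_imp_open_map unfolding is_chart_def open_map_def
    by (metis openin_open_subtopology)
  then show ?thesis
    using assms(1) openin_open_trans unfolding is_chart_def by blast
qed

lemma continuous_map_chart_inv:
  assumes "is_chart X C"
  shows "continuous_map (top_of_set (coord C ` chart_dom C)) X (chart_inv C)"
  unfolding continuous_map_def
proof (intro conjI allI impI)
  show "chart_inv C \<in> topspace (top_of_set (coord C ` chart_dom C)) \<rightarrow> topspace X"
    using assms chart_dom_subset by (fastforce intro: inv_into_into)
  fix U assume U: "openin X U"
  have "{u \<in> coord C ` chart_dom C. chart_inv C u \<in> U} = coord C ` (U \<inter> chart_dom C)"
    using chart_inv_coord[OF assms] by auto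
  moreover have "open (coord C ` (U \<inter> chart_dom C))"
    using assms U by (intro chart_open_image[OF assms]) (auto simp: is_chart_def)
  ultimately show "openin (top_of_set (coord C ` chart_dom C))
      {u \<in> topspace (top_of_set (coord C ` chart_dom C)). chart_inv C u \<in> U}"
    using assms by (auto simp: is_chart_def openin_open_eq)
qed

lemma openin_coord_preimage:
  assumes "is_chart X C" "open V"
  shows "openin X {a \<in> chart_dom C. coord C a \<in> V}"
proof -
  have "continuous_map (subtopology X (chart_dom C)) (top_of_set (coord C ` chart_dom C)) (coord C)"
    using assms by (simp add: is_chart_def homeomorphic_imp_continuous_map)
  then have "continuous_map (subtopology X (chart_dom C)) euclidean (coord C)"
    using continuous_map_in_subtopology by blast
  then have "openin (subtopology X (chart_dom C)) {a \<in> topspace (subtopology X (chart_dom C)). coord C a \<in> V}"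
    by (rule openin_continuous_map_preimage) (use assms(2) in simp)
  moreover have "topspace (subtopology X (chart_dom C)) = chart_dom C"
    using chart_dom_subset[OF assms(1)] by auto
  ultimately have "openin (subtopology X (chart_dom C)) {a \<in> chart_dom C. coord C a \<in> V}"
    by (simp only:)
  then show ?thesis
    using assms(1) by (simp add: is_chart_def openin_open_subtopology)
qed

text \<open>The bridge by which limits computed in coordinates become statements on open sets of the
  manifold.\<close>

lemma eventually_nhds_coord_imp_open:
  assumes "is_chart X C" "a \<in> chart_dom C" "eventually P (nhds (coord C a))"
  obtains U where "openin X U" "a \<in> U" "U \<subseteq> chart_dom C" "\<And>b. b \<in> U \<Longrightarrow> P (coord C b)"
proof -
  obtain V where V: "open V" "coord C a \<in> V" "\<And>u. u \<in> V \<Longrightarrow> P u"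
    using assms(3) by (auto simp: eventually_nhds)
  show ?thesis
    by (rule that[OF openin_coord_preimage[OF assms(1) V(1)]]) (use assms V in auto)
qed

lemma riemannian_manifold_is_chart: "riemannian_manifold M \<Longrightarrow> C \<in> atlas M \<Longrightarrow> is_chart (mtop M) C"
  by (simp add: riemannian_manifold_def smooth_manifold_def smooth_atlas_def)

lemma riemannian_manifold_chart_exists:
  assumes "riemannian_manifold M" "a \<in> topspace (mtop M)"
  obtains C where "C \<in> atlas M" "a \<in> chart_dom C"
proof -
  have "(\<Union>C\<in>atlas M. chart_dom C) = topspace (mtop M)"
    using assms(1) by (simp add: riemannian_manifold_def smooth_manifold_def smooth_atlas_def)
  then show ?thesis using assms(2) that by blast
qed

lemma openin_chart_dom: "riemannian_manifold M \<Longrightarrow> C \<in> atlas M \<Longrightarrow> openin (mtop M) (chart_dom C)"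
  using riemannian_manifold_is_chart unfolding is_chart_def by blast

lemma chart_at:
  assumes "riemannian_manifold M" "a \<in> topspace (mtop M)"
  shows "chart_at M a \<in> atlas M" "a \<in> chart_dom (chart_at M a)"
  using someI_ex[of "\<lambda>C. C \<in> atlas M \<and> a \<in> chart_dom C"] riemannian_manifold_chart_exists[OF assms]
  unfolding chart_at_def by blast+

lemma posdef_metric: "riemannian_manifold M \<Longrightarrow> C \<in> atlas M \<Longrightarrow> a \<in> chart_dom C \<Longrightarrow> posdef (metric M C a)"
  by (simp add: riemannian_manifold_def posdef_def)

lemma metric_transform:
  assumes "riemannian_manifold M" "C \<in> atlas M" "D \<in> atlas M" "a \<in> chart_dom C \<inter> chart_dom D"
  shows "metric M C a = transpose (jacobian (transition C D) (at (coord C a))) ** metric M D a **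
    jacobian (transition C D) (at (coord C a))"
  using assms unfolding riemannian_manifold_def Let_def by blast

lemma smooth_on_metric:
  "riemannian_manifold M \<Longrightarrow> C \<in> atlas M \<Longrightarrow>
    smooth_on (coord C ` chart_dom C) (\<lambda>u. metric M C (chart_inv C u))"
  by (simp add: riemannian_manifold_def)

lemma smooth_on_tensor_field:
  "tensor_field M N T \<Longrightarrow> C \<in> atlas M \<Longrightarrow> D \<in> atlas N \<Longrightarrow>
    smooth_on ((coord C ` chart_dom C) \<times> (coord D ` chart_dom D))
          (\<lambda>(u, v). T C D (chart_inv C u) (chart_inv D v))"
  by (simp add: tensor_field_def)

section \<open>Transformation laws and independence of the charts\<close>

lemma transition_has_derivative:
  assumes "riemannian_manifold M" "C \<in> atlas M" "D \<in> atlas M" "a \<in> chart_dom C \<inter> chart_dom D"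
  shows "(transition C D has_derivative (*v) (jacobian (transition C D) (at (coord C a)))) (at (coord C a))"
proof -
  have "smooth_on (coord C ` (chart_dom C \<inter> chart_dom D)) (transition C D)"
    using assms by (simp add: riemannian_manifold_def smooth_manifold_def smooth_atlas_def)
  then have "transition C D differentiable (at (coord C a))"
    using assms(4) smooth_on_differentiable by blast
  then show ?thesis using jacobian_works by blast
qed

lemma smooth_map_has_derivative:
  assumes "smooth_map M N h" "C \<in> atlas M" "D \<in> atlas N" "a \<in> chart_dom C" "h a \<in> chart_dom D"
  shows "(coord D \<circ> h \<circ> chart_inv C has_derivative (*v) (differential h C D a)) (at (coord C a))"
proof -
  have "coord D \<circ> h \<circ> chart_inv C differentiable (at (coord C a))"
    using assms by (intro smooth_on_differentiable) (auto simp: smooth_map_def)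
  then show ?thesis unfolding differential_def using jacobian_works by blast
qed

lemma differential_transform:
  assumes M: "riemannian_manifold M" and N: "riemannian_manifold N" and h: "smooth_map M N h"
    and charts: "C \<in> atlas M" "C' \<in> atlas M" "D \<in> atlas N" "D' \<in> atlas N"
    and a: "a \<in> chart_dom C \<inter> chart_dom C'" and ha: "h a \<in> chart_dom D \<inter> chart_dom D'"
  shows "differential h C' D' a = jacobian (transition D D') (at (coord D (h a))) **
    differential h C D a ** jacobian (transition C' C) (at (coord C' a))"
proof -
  let ?B = "jacobian (transition D D') (at (coord D (h a)))"
  let ?A = "jacobian (transition C' C) (at (coord C' a))"
  let ?g = "coord D \<circ> h \<circ> chart_inv C"
  let ?f = "transition D D' \<circ> (?g \<circ> transition C' C)"
  note ch = riemannian_manifold_is_chart[OF M charts(1)] riemannian_manifold_is_chart[OF M charts(2)]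
    riemannian_manifold_is_chart[OF N charts(3)] riemannian_manifold_is_chart[OF N charts(4)]
  have pt: "transition C' C (coord C' a) = coord C a" "?g (coord C a) = coord D (h a)"
    using a ch by (simp_all add: chart_inv_coord)
  have A: "(transition C' C has_derivative (*v) ?A) (at (coord C' a))"
    using a by (intro transition_has_derivative[OF M charts(2,1)]) auto
  have g: "(?g has_derivative (*v) (differential h C D a)) (at (transition C' C (coord C' a)))"
    unfolding pt using a ha by (intro smooth_map_has_derivative[OF h charts(1,3)]) auto
  have B: "(transition D D' has_derivative (*v) ?B) (at ((?g \<circ> transition C' C) (coord C' a)))"
    using transition_has_derivative[OF N charts(3,4) ha] pt by simp
  have "(?f has_derivative (*v) ?B \<circ> ((*v) (differential h C D a) \<circ> (*v) ?A)) (at (coord C' a))"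
    by (intro diff_chain_at A g B)
  then have d: "(?f has_derivative (*v) (?B ** differential h C D a ** ?A)) (at (coord C' a))"
    by (simp add: comp_def matrix_vector_mul_assoc matrix_mul_assoc)
  \<comment> \<open>On \<open>U\<close>, intersected with both chart domains in \<open>M\<close>,
    the point and its image lie in all four charts, so the inserted coordinate maps and their
    inverses cancel. Elsewhere the two representatives may differ; openness of this set lets the
    derivative be transferred.\<close>
  define U where "U = {b \<in> topspace (mtop M). h b \<in> chart_dom D \<inter> chart_dom D'}"
  have U: "openin (mtop M) U"
    unfolding U_def using h ch
    by (intro openin_continuous_map_preimage[of _ "mtop N"]) (auto simp: smooth_map_def is_chart_def)
  have "openin (mtop M) (U \<inter> chart_dom C \<inter> chart_dom C')"
    using U ch by (auto simp: is_chart_def)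
  then have op: "open (coord C' ` (U \<inter> chart_dom C \<inter> chart_dom C'))"
    by (intro chart_open_image[OF ch(2)]) auto
  have "a \<in> U" using a ha chart_dom_subset[OF ch(1)] by (auto simp: U_def)
  then have "(coord D' \<circ> h \<circ> chart_inv C' has_derivative (*v) (?B ** differential h C D a ** ?A)) (at (coord C' a))"
    by (intro has_derivative_transform_within_open[OF d op])
      (use a ch in \<open>auto simp: chart_inv_coord U_def\<close>)
  then show ?thesis
    unfolding differential_def[of h C'] by (rule jacobian_eqI)
qed

text \<open>The two metrics transform in opposite directions: \<open>metric M C' a\<close> arises
  from \<open>metric M C a\<close> by \<open>A\<close>, but \<open>metric N D x\<close> from
  \<open>metric N D' x\<close> by \<open>B\<close>. The action of \<open>A\<close> and
  \<open>B\<close> on the tensors compensates exactly this.\<close>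

lemma tensor_inner_transform:
  assumes M: "riemannian_manifold M" and N: "riemannian_manifold N"
    and charts: "C \<in> atlas M" "C' \<in> atlas M" "D \<in> atlas N" "D' \<in> atlas N"
    and a: "a \<in> chart_dom C \<inter> chart_dom C'" and x: "x \<in> chart_dom D \<inter> chart_dom D'"
    and A: "A = jacobian (transition C' C) (at (coord C' a))"
    and B: "B = jacobian (transition D D') (at (coord D x))"
  shows "tensor_inner M N C' D' a x (B ** S ** A) (B ** T ** A) = tensor_inner M N C D a x S T"
proof -
  have m: "metric M C' a = transpose A ** metric M C a ** A"
    unfolding A using a charts by (intro metric_transform[OF M]) auto
  have n: "metric N D x = transpose B ** metric N D' x ** B"
    unfolding B using x charts by (intro metric_transform[OF N]) auto
  have "posdef (metric M C a)" "posdef (transpose A ** metric M C a ** A)"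
    using posdef_metric[OF M charts(1), of a] posdef_metric[OF M charts(2), of a] a
    by (simp_all flip: m)
  then have "A ** matrix_inv (metric M C' a) ** transpose A = matrix_inv (metric M C a)"
    unfolding m by (rule posdef_congruence)
  then show ?thesis
    by (simp add: tensor_inner_eq_tensor_form tensor_form_mult n)
qed

definition LT_density where
  "LT_density M N T h a = scalar_prod M N h (differential h) (differential h) a *
       scalar_prod M N h (along T h) (along T h) a /
       (scalar_prod M N h (differential h) (along T h) a)\<^sup>2"

text \<open>\<open>scalar_prod\<close> uses charts picked by choice at each point separately, and
  these may jump from one point to the next. Limits and estimates become possible once it is
  computed in a fixed pair of charts. The differential and the tensor along the map are the sections
  whose transformation laws are at hand.\<close>

lemma scalar_prod_in_charts:
  assumes M: "riemannian_manifold M" and N: "riemannian_manifold N"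
    and T: "tensor_field M N T" and h: "smooth_map M N h"
    and charts: "C \<in> atlas M" "D \<in> atlas N" and a: "a \<in> chart_dom C" "h a \<in> chart_dom D"
    and S: "S \<in> {differential h, along T h}" "S' \<in> {differential h, along T h}"
  shows "scalar_prod M N h S S' a = tensor_inner M N C D a (h a) (S C D a) (S' C D a)"
proof -
  have at: "a \<in> topspace (mtop M)" "h a \<in> topspace (mtop N)"
    using a openin_subset[OF openin_chart_dom[OF M charts(1)]]
      openin_subset[OF openin_chart_dom[OF N charts(2)]] by blast+
  let ?C = "chart_at M a" and ?D = "chart_at N (h a)"
  note ca = chart_at[OF M at(1)] chart_at[OF N at(2)]
  let ?A = "jacobian (transition ?C C) (at (coord ?C a))"
  let ?B = "jacobian (transition D ?D) (at (coord D (h a)))"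
  have *: "R ?C ?D a = ?B ** R C D a ** ?A" if "R \<in> {differential h, along T h}" for R
  proof -
    have "along T h ?C ?D a = ?B ** along T h C D a ** ?A"
      using T ca charts a unfolding tensor_field_def along_def by blast
    then show ?thesis
      using that ca charts a differential_transform[OF M N h charts(1) ca(1) charts(2) ca(3)] by auto
  qed
  show ?thesis
    unfolding scalar_prod_def Let_def *[OF S(1)] *[OF S(2)]
    by (rule tensor_inner_transform[OF M N charts(1) ca(1) charts(2) ca(3)]) (use a ca in auto)
qed

lemma LT_density_in_charts:
  assumes "riemannian_manifold M" "riemannian_manifold N" "tensor_field M N T" "smooth_map M N h"
    "C \<in> atlas M" "D \<in> atlas N" "a \<in> chart_dom C" "h a \<in> chart_dom D"
  shows "LT_density M N T h a = tensor_ratio (matrix_inv (metric M C a)) (metric N D (h a))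
    (differential h C D a) (T C D a (h a))"
  unfolding LT_density_def tensor_ratio_def
  by (simp add: scalar_prod_in_charts[OF assms] tensor_inner_eq_tensor_form)
    (simp add: along_def)

lemma tensor_form_differential_nonzero:
  assumes "riemannian_manifold M" "riemannian_manifold N" "tensor_field M N T" "h \<in> LT_domain M N T"
    "C \<in> atlas M" "D \<in> atlas N" "a \<in> chart_dom C" "h a \<in> chart_dom D"
  shows "tensor_form (matrix_inv (metric M C a)) (metric N D (h a))
    (differential h C D a) (T C D a (h a)) \<noteq> 0"
proof -
  have "a \<in> topspace (mtop M)"
    using assms(7) openin_subset[OF openin_chart_dom[OF assms(1,5)]] by blast
  then have "scalar_prod M N h (differential h) (along T h) a \<noteq> 0" "smooth_map M N h"
    using assms(4) by (auto simp: LT_domain_def)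
  then show ?thesis
    using scalar_prod_in_charts[of M N T h C D a "differential h" "along T h"] assms
    by (simp add: tensor_inner_eq_tensor_form) (simp add: along_def)
qed

section \<open>Limits of the metrics and the tensor in coordinates; continuity of the
  density\<close>

lemma smooth_on_tendsto_compose:
  assumes "smooth_on S f" "l \<in> S" "(g \<longlongrightarrow> l) F"
  shows "((\<lambda>z. f (g z)) \<longlongrightarrow> f l) F"
  using smooth_on_tendsto[OF assms(1,2)] assms(3) by (rule filterlim_compose)

lemma tendsto_inverse_metric:
  assumes "riemannian_manifold M" "C \<in> atlas M" "a \<in> chart_dom C" "(u \<longlongrightarrow> coord C a) F"
  shows "((\<lambda>z. matrix_inv (metric M C (chart_inv C (u z)))) \<longlongrightarrow> matrix_inv (metric M C a)) F"
proof (rule tendsto_matrix_inv)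
  show "((\<lambda>z. metric M C (chart_inv C (u z))) \<longlongrightarrow> metric M C a) F"
    using smooth_on_tendsto_compose[OF smooth_on_metric[OF assms(1,2)] _ assms(4)] assms(3)
      chart_inv_coord[OF riemannian_manifold_is_chart[OF assms(1,2)] assms(3)] by simp
  show "invertible (metric M C a)"
    by (rule posdef_invertible[OF posdef_metric[OF assms(1-3)]])
qed

lemma tendsto_metric:
  assumes "riemannian_manifold M" "C \<in> atlas M" "a \<in> chart_dom C" "(u \<longlongrightarrow> coord C a) F"
  shows "((\<lambda>z. metric M C (chart_inv C (u z))) \<longlongrightarrow> metric M C a) F"
    using smooth_on_tendsto_compose[OF smooth_on_metric[OF assms(1,2)] _ assms(4)] assms(3)
      chart_inv_coord[OF riemannian_manifold_is_chart[OF assms(1,2)] assms(3)] by simp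

lemma tendsto_tensor_field:
  assumes M: "riemannian_manifold M" and N: "riemannian_manifold N" and "tensor_field M N T"
    and charts: "C \<in> atlas M" "D \<in> atlas N" and a: "a \<in> chart_dom C" "x \<in> chart_dom D"
    and u: "(u \<longlongrightarrow> coord C a) F" and v: "(v \<longlongrightarrow> coord D x) F"
  shows "((\<lambda>z. T C D (chart_inv C (u z)) (chart_inv D (v z))) \<longlongrightarrow> T C D a x) F"
  using smooth_on_tendsto_compose[OF smooth_on_tensor_field[OF assms(3) charts] _ tendsto_Pair[OF u v]] a
    chart_inv_coord[OF riemannian_manifold_is_chart[OF M charts(1)] a(1)]
    chart_inv_coord[OF riemannian_manifold_is_chart[OF N charts(2)] a(2)] by simp

lemma eventually_posdef_metric:
  assumes M: "riemannian_manifold M" and "C \<in> atlas M" "a \<in> chart_dom C" "(u \<longlongrightarrow> coord C a) F"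
  shows "eventually (\<lambda>z. u z \<in> coord C ` chart_dom C \<and> posdef (metric M C (chart_inv C (u z)))) F"
proof -
  have "open (coord C ` chart_dom C)"
    using riemannian_manifold_is_chart[OF assms(1,2)] by (simp add: is_chart_def)
  then have "eventually (\<lambda>z. u z \<in> coord C ` chart_dom C) F"
    using assms(3,4) by (intro topological_tendstoD) auto
  then show ?thesis
    by eventually_elim (use posdef_metric[OF assms(1,2)] in
      \<open>auto simp: chart_inv_coord[OF riemannian_manifold_is_chart[OF assms(1,2)]]\<close>)
qed

lemma openin_smooth_map_preimage:
  assumes "riemannian_manifold M" "riemannian_manifold N" "smooth_map M N h" "C \<in> atlas M" "D \<in> atlas N"
  shows "openin (mtop M) {a \<in> chart_dom C. h a \<in> chart_dom D}"
proof -
  have "openin (mtop M) (chart_dom C \<inter> {a \<in> topspace (mtop M). h a \<in> chart_dom D})"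
    using openin_chart_dom[OF assms(1,4)] openin_chart_dom[OF assms(2,5)] assms(3)
    by (intro openin_Int openin_continuous_map_preimage[of _ "mtop N"])
      (auto simp: smooth_map_def)
  also have "chart_dom C \<inter> {a \<in> topspace (mtop M). h a \<in> chart_dom D} = {a \<in> chart_dom C. h a \<in> chart_dom D}"
    using chart_dom_subset[OF riemannian_manifold_is_chart[OF assms(1,4)]] by auto
  finally show ?thesis .
qed

text \<open>Continuity provides measurability of the integrand, since the measurable sets of
  \<open>riem_vol\<close> are the Borel sets of the topology. Membership of \<open>h\<close> in the
  domain keeps the denominator nonzero.\<close>

lemma continuous_map_LT_density:
  assumes M: "riemannian_manifold M" and N: "riemannian_manifold N" and T: "tensor_field M N T"
    and h: "h \<in> LT_domain M N T"
  shows "continuous_map (mtop M) euclideanreal (LT_density M N T h)"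
  unfolding continuous_map_eq_topcontinuous_at
proof
  fix a assume a: "a \<in> topspace (mtop M)"
  have sm: "smooth_map M N h" using h by (simp add: LT_domain_def)
  then have "h a \<in> topspace (mtop N)"
    using a by (auto simp: smooth_map_def continuous_map_def)
  then obtain D where D_atlas: "D \<in> atlas N" and D: "h a \<in> chart_dom D"
    using riemannian_manifold_chart_exists[OF N] by blast
  obtain C where C_atlas: "C \<in> atlas M" and C: "a \<in> chart_dom C"
    using riemannian_manifold_chart_exists[OF M a] by blast
  note charts = C_atlas D_atlas
  note ch = riemannian_manifold_is_chart[OF M charts(1)] riemannian_manifold_is_chart[OF N charts(2)]
  let ?u = "coord C a" and ?W = "{a \<in> chart_dom C. h a \<in> chart_dom D}"
  define g where "g = coord D \<circ> h \<circ> chart_inv C"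
  have g: "smooth_on (coord C ` ?W) g"
    using sm charts by (simp add: smooth_map_def g_def)
  define Q where "Q u = tensor_ratio (matrix_inv (metric M C (chart_inv C u))) (metric N D (chart_inv D (g u)))
    (jacobian g (at u)) (T C D (chart_inv C u) (chart_inv D (g u)))" for u
  have gu: "g ?u = coord D (h a)" using C ch by (simp add: g_def chart_inv_coord)
  have gt: "(g \<longlongrightarrow> coord D (h a)) (nhds ?u)"
    using smooth_on_tendsto[OF g, of ?u] C D gu by simp
  have Jt: "((\<lambda>u. jacobian g (at u)) \<longlongrightarrow> jacobian g (at ?u)) (nhds ?u)"
    using tendsto_jacobian[OF g] C D by blast
  have id: "((\<lambda>u. u) \<longlongrightarrow> ?u) (nhds ?u)" by (rule filterlim_ident)
  have nz: "tensor_form (matrix_inv (metric M C a)) (metric N D (h a)) (jacobian g (at ?u)) (T C D a (h a)) \<noteq> 0"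
    using tensor_form_differential_nonzero[OF M N T h charts C D] by (simp add: differential_def g_def)
  have "(Q \<longlongrightarrow> tensor_ratio (matrix_inv (metric M C a)) (metric N D (h a)) (jacobian g (at ?u)) (T C D a (h a))) (nhds ?u)"
    unfolding Q_def tensor_ratio_def using nz
    by (intro tendsto_intros tendsto_inverse_metric[OF M charts(1) C] tendsto_metric[OF N charts(2) D]
        tendsto_tensor_field[OF M N T charts C D] gt Jt id) auto
  then have Qt: "(Q \<longlongrightarrow> LT_density M N T h a) (nhds ?u)"
    by (simp add: LT_density_in_charts[OF M N T sm charts C D] differential_def g_def)
  have QW: "LT_density M N T h b = Q (coord C b)" if "b \<in> ?W" for b
    using that ch LT_density_in_charts[OF M N T sm charts, of b]
    by (simp add: Q_def g_def differential_def chart_inv_coord)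
  show "topcontinuous_at (mtop M) euclideanreal (LT_density M N T h) a"
    unfolding topcontinuous_at_def
  proof (intro conjI allI impI)
    fix V assume V: "openin euclideanreal V \<and> LT_density M N T h a \<in> V"
    then have "eventually (\<lambda>u. Q u \<in> V) (nhds ?u)"
      using Qt topological_tendstoD by auto
    then obtain U where U: "openin (mtop M) U" "a \<in> U" "U \<subseteq> chart_dom C" "\<And>b. b \<in> U \<Longrightarrow> Q (coord C b) \<in> V"
      using eventually_nhds_coord_imp_open[OF ch(1) C] by blast
    have "openin (mtop M) (U \<inter> ?W)"
      using U openin_smooth_map_preimage[OF M N sm charts] by blast
    then show "\<exists>U. openin (mtop M) U \<and> a \<in> U \<and> (\<forall>b\<in>U. LT_density M N T h b \<in> V)"
      using U QW C D by (intro exI[of _ "U \<inter> ?W"]) auto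
  qed (use a in auto)
qed

section \<open>The Riemannian volume and derivatives along a variation\<close>

text \<open>The volume density is bounded near \<open>coord C a\<close> by continuity, and the
  neighbourhood is kept inside a unit ball of coordinates, which has finite Lebesgue measure. A
  compact manifold is covered by finitely many such neighbourhoods.\<close>

lemma chart_vol_finite_nbhd:
  assumes M: "riemannian_manifold M" and C: "C \<in> atlas M" and a: "a \<in> chart_dom C"
  obtains U where "openin (mtop M) U" "a \<in> U" "U \<subseteq> chart_dom C" "chart_vol M C U < \<infinity>"
proof -
  let ?d = "\<lambda>u. sqrt (det (metric M C (chart_inv C u)))"
  have "(?d \<longlongrightarrow> sqrt (det (metric M C a))) (nhds (coord C a))"
    by (intro tendsto_intros tendsto_metric[OF M C a] filterlim_ident)
  then have "eventually (\<lambda>u. ?d u < sqrt (det (metric M C a)) + 1) (nhds (coord C a))"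
    by (rule order_tendstoD) simp
  moreover have "eventually (\<lambda>u. u \<in> ball (coord C a) 1) (nhds (coord C a))"
    by (rule eventually_nhds_in_open) auto
  ultimately have "eventually (\<lambda>u. ?d u < sqrt (det (metric M C a)) + 1 \<and> u \<in> ball (coord C a) 1) (nhds (coord C a))"
    by eventually_elim simp
  then obtain U where U: "openin (mtop M) U" "a \<in> U" "U \<subseteq> chart_dom C"
    and bd: "\<And>b. b \<in> U \<Longrightarrow> ?d (coord C b) < sqrt (det (metric M C a)) + 1 \<and> coord C b \<in> ball (coord C a) 1"
    using eventually_nhds_coord_imp_open[OF riemannian_manifold_is_chart[OF M C] a] by blast
  have "chart_vol M C U \<le> (\<integral>\<^sup>+ u. ennreal (sqrt (det (metric M C a)) + 1) * indicator (ball (coord C a) 1) u \<partial>lborel)"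
    unfolding chart_vol_def using bd
    by (intro nn_integral_mono) (fastforce split: split_indicator intro!: ennreal_leI)
  also have "\<dots> = ennreal (sqrt (det (metric M C a)) + 1) * emeasure lborel (ball (coord C a) 1)"
    by (simp add: nn_integral_cmult_indicator)
  also have "\<dots> < \<infinity>"
    using emeasure_lborel_ball_finite[of "coord C a" 1] by (simp add: ennreal_mult_less_top)
  finally show ?thesis using that U by blast
qed

lemma compact_space_finite_subcover:
  assumes "compact_space X" "\<And>a. a \<in> topspace X \<Longrightarrow> openin X (U a) \<and> a \<in> U a"
  obtains K where "finite K" "K \<subseteq> topspace X" "topspace X \<subseteq> (\<Union>a\<in>K. U a)"
proof -
  have "\<exists>\<F>. finite \<F> \<and> \<F> \<subseteq> U ` topspace X \<and> topspace X \<subseteq> \<Union>\<F>"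
    using assms(1)[unfolded compact_space_alt, rule_format, of "U ` topspace X"] assms(2) by blast
  then show ?thesis
    using that by (metis finite_subset_image)
qed

lemma space_riem_vol: "space (riem_vol M) = topspace (mtop M)"
  unfolding riem_vol_def by (rule space_measure_of) (auto dest: openin_subset)

lemma sets_riem_vol: "sets (riem_vol M) = borel_sets (mtop M)"
  unfolding riem_vol_def borel_sets_def by (rule sets_measure_of) (auto dest: openin_subset)

lemma continuous_map_measurable_riem_vol:
  assumes "continuous_map (mtop M) euclideanreal q"
  shows "q \<in> borel_measurable (riem_vol M)"
proof (rule borel_measurableI)
  fix S :: "real set" assume "open S"
  then have "openin (mtop M) {a \<in> topspace (mtop M). q a \<in> S}"
    by (intro openin_continuous_map_preimage[OF assms]) simp
  moreover have "q -` S \<inter> space (riem_vol M) = {a \<in> topspace (mtop M). q a \<in> S}"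
    by (auto simp: space_riem_vol)
  ultimately show "q -` S \<inter> space (riem_vol M) \<in> sets (riem_vol M)"
    by (simp add: sets_riem_vol borel_sets_def sigma_sets.Basic)
qed

text \<open>The defining infimum need not be shown to be a measure: if it were not, \<open>measure_of\<close> would
  be the null measure, which is finite as well.\<close>

lemma finite_measure_riem_vol:
  assumes M: "riemannian_manifold M" and comp: "compact_space (mtop M)"
  shows "finite_measure (riem_vol M)"
proof
  let ?X = "topspace (mtop M)"
  define \<mu> where "\<mu> = (\<lambda>E. INF (C, P) \<in> {(C :: nat \<Rightarrow> ('a, 'b) chart, P :: nat \<Rightarrow> 'a set).
              (\<forall>k. C k \<in> atlas M \<and> P k \<in> borel_sets (mtop M) \<and> P k \<subseteq> chart_dom (C k)) \<and>
              E \<subseteq> (\<Union>k. P k)}.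
            \<Sum>k. chart_vol M (C k) (P k))"
  have riem_vol: "riem_vol M = measure_of ?X {U. openin (mtop M) U} \<mu>"
    by (simp add: riem_vol_def \<mu>_def)
  have "emeasure (riem_vol M) ?X \<noteq> \<infinity>"
  proof (cases "?X = {}")
    case True
    then show ?thesis by simp
  next
    case False
    have "\<exists>C U. C \<in> atlas M \<and> openin (mtop M) U \<and> a \<in> U \<and> U \<subseteq> chart_dom C \<and> chart_vol M C U < \<infinity>"
      if a: "a \<in> ?X" for a
    proof -
      obtain C where "C \<in> atlas M" "a \<in> chart_dom C"
        using riemannian_manifold_chart_exists[OF M a] by blast
      then show ?thesis using chart_vol_finite_nbhd[OF M] by metis
    qed
    then obtain C U where CU: "\<And>a. a \<in> ?X \<Longrightarrow> C a \<in> atlas M \<and> openin (mtop M) (U a) \<and> a \<in> U a \<and>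
        U a \<subseteq> chart_dom (C a) \<and> chart_vol M (C a) (U a) < \<infinity>"
      by metis
    obtain K where K: "finite K" "K \<subseteq> ?X" "?X \<subseteq> (\<Union>a\<in>K. U a)"
      using compact_space_finite_subcover[OF comp, of U] CU by blast
    obtain xs where xs: "set xs = K" using finite_list[OF K(1)] by blast
    have "xs \<noteq> []" using xs K False by auto
    \<comment> \<open>The covers in the infimum are indexed by all of \<open>nat\<close>. Past the
      end of the list the piece \<open>P k\<close> is empty, while the index falls back to the first
      element, because every \<open>C (c k)\<close> must still belong to the atlas.\<close>
    define c where "c k = xs ! (if k < length xs then k else 0)" for k
    define P where "P k = (if k < length xs then U (c k) else {})" for k
    have c: "c k \<in> ?X" for k
      using \<open>xs \<noteq> []\<close> xs K by (auto simp: c_def)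
    have cover: "?X \<subseteq> (\<Union>k. P k)"
    proof
      fix b assume "b \<in> ?X"
      then obtain a where "a \<in> set xs" "b \<in> U a" using K xs by auto
      then obtain k where "k < length xs" "b \<in> U (xs ! k)" by (metis in_set_conv_nth)
      then show "b \<in> (\<Union>k. P k)" by (auto simp: P_def c_def intro!: exI[of _ k])
    qed
    have adm: "C (c k) \<in> atlas M \<and> P k \<in> borel_sets (mtop M) \<and> P k \<subseteq> chart_dom (C (c k))" for k
      using CU[OF c[of k]] by (auto simp: P_def borel_sets_def intro: sigma_sets.Basic)
    have "\<mu> ?X \<le> (\<Sum>k. chart_vol M (C (c k)) (P k))"
      unfolding \<mu>_def by (rule INF_lower2[of "(\<lambda>k. C (c k), P)"]) (use adm cover in auto)
    also have "\<dots> = (\<Sum>k<length xs. chart_vol M (C (c k)) (P k))"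
      by (rule suminf_finite) (auto simp: P_def chart_vol_def)
    also have "\<dots> < \<infinity>"
      using CU[OF c] by (auto simp: P_def)
    finally have "\<mu> ?X < \<infinity>" .
    moreover have "{U. openin (mtop M) U} \<subseteq> Pow ?X" by (auto dest: openin_subset)
    ultimately show ?thesis
      unfolding riem_vol by (subst emeasure_measure_of_conv) auto
  qed
  then show "emeasure (riem_vol M) (space (riem_vol M)) \<noteq> \<infinity>"
    by (simp add: space_riem_vol)
qed

section \<open>Lipschitz dependence on time near time zero\<close>

lemma smooth_on_lipschitz_fst:
  fixes f :: "real \<times> 'a::euclidean_space \<Rightarrow> 'b::real_normed_vector"
  assumes "open S" "smooth_on S f" "(0, u0) \<in> S"
  obtains L where "L > 0"
    "eventually (\<lambda>z. norm (f z - f (0, snd z)) \<le> L * \<bar>fst z\<bar>) (nhds (0, u0))"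
proof -
  obtain r L where r: "r > 0" "L > 0" "ball (0, u0) r \<subseteq> S"
    "\<And>y z. y \<in> ball (0, u0) r \<Longrightarrow> z \<in> ball (0, u0) r \<Longrightarrow> norm (f y - f z) \<le> L * norm (y - z)"
    using smooth_on_lipschitz_ball[OF assms] by blast
  have "eventually (\<lambda>z. z \<in> ball (0, u0) r) (nhds (0, u0))"
    using r(1) by (intro eventually_nhds_in_open) auto
  then have "eventually (\<lambda>z. norm (f z - f (0, snd z)) \<le> L * \<bar>fst z\<bar>) (nhds (0, u0))"
  proof eventually_elim
    case (elim z)
    \<comment> \<open>The centre lies at time \<open>0\<close>, so resetting the time of
      \<open>z\<close> to \<open>0\<close> keeps it in the ball.\<close>
    have "dist (0, u0) (0, snd z) \<le> dist (0::real, u0) z"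
      by (cases z) (simp add: dist_Pair_Pair)
    then have "norm (f z - f (0, snd z)) \<le> L * norm (z - (0, snd z))"
      using elim by (intro r(4)) (auto simp: mem_ball elim: le_less_trans)
    also have "norm (z - (0, snd z)) = \<bar>fst z\<bar>"
      by (cases z) (simp add: norm_Pair)
    finally show ?case .
  qed
  then show ?thesis using that r(2) by blast
qed

text \<open>The norm of a matrix is built from its rows, whereas Jacobians are controlled column by
  column, each column being a directional derivative. Each row obeys the same bound, whence the
  factor \<open>CARD('n)\<close>.\<close>

lemma norm_matrix_le_columns:
  fixes A :: "real^'m^'n"
  shows "norm A \<le> CARD('n) * (\<Sum>\<alpha>\<in>UNIV. norm (column \<alpha> A))"
proof -
  have "norm (A $ i) \<le> (\<Sum>\<alpha>\<in>UNIV. norm (column \<alpha> A))" for i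
  proof -
    have "\<bar>A $ i $ \<alpha>\<bar> \<le> norm (column \<alpha> A)" for \<alpha>
      using component_le_norm_cart[of "column \<alpha> A" i] by (simp add: column_def)
    then show ?thesis
      by (intro order_trans[OF norm_le_l1_cart] sum_mono)
  qed
  then have "(\<Sum>i\<in>UNIV. norm (A $ i)) \<le> (\<Sum>i\<in>(UNIV::'n set). \<Sum>\<alpha>\<in>UNIV. norm (column \<alpha> A))"
    by (rule sum_mono)
  moreover have "norm A \<le> (\<Sum>i\<in>UNIV. norm (A $ i))"
    unfolding norm_vec_def by (rule L2_set_le_sum) simp
  ultimately show ?thesis by simp
qed

text \<open>The Jacobian in the space variable alone. It is read off from the joint derivative in
  time and space rather than from the slice at a fixed time, so that smoothness of \<open>g\<close>
  controls it in both variables; \<open>jacobian_slice\<close> identifies it with the derivative of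
  the slice.\<close>

definition partial_jacobian :: "(real \<times> (real^'m) \<Rightarrow> real^'n) \<Rightarrow> real \<times> (real^'m) \<Rightarrow> real^'m^'n" where
  "partial_jacobian g z = matrix (\<lambda>h. frechet_derivative g (at z) (0, h))"

lemma column_partial_jacobian:
  "column \<alpha> (partial_jacobian g z) = frechet_derivative g (at z) (0, axis \<alpha> 1)"
  by (simp add: partial_jacobian_def matrix_def column_def vec_eq_iff)

text \<open>Each column is a directional derivative of \<open>g\<close>, hence smooth and Lipschitz
  in time. There are finitely many columns, so their bounds hold simultaneously near
  \<open>(0, u0)\<close>.\<close>

lemma partial_jacobian_lipschitz_fst:
  fixes g :: "real \<times> (real^'m) \<Rightarrow> real^'n"
  assumes "open S" "smooth_on S g" "(0, u0) \<in> S"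
  obtains L where "L > 0"
    "eventually (\<lambda>z. norm (partial_jacobian g z - partial_jacobian g (0, snd z)) \<le> L * \<bar>fst z\<bar>) (nhds (0, u0))"
proof -
  have "\<exists>L. L > 0 \<and> eventually (\<lambda>z. norm (column \<alpha> (partial_jacobian g z) - column \<alpha> (partial_jacobian g (0, snd z)))
      \<le> L * \<bar>fst z\<bar>) (nhds (0, u0))" for \<alpha>
    unfolding column_partial_jacobian
    by (rule smooth_on_lipschitz_fst[OF assms(1) smooth_on_frechet_derivative[OF assms(2)] assms(3)]) blast
  then have "\<forall>\<alpha>. \<exists>L. L > 0 \<and> eventually (\<lambda>z. norm (column \<alpha> (partial_jacobian g z) -
      column \<alpha> (partial_jacobian g (0, snd z))) \<le> L * \<bar>fst z\<bar>) (nhds (0, u0))"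
    by (rule allI)
  from choice[OF this] obtain L where L': "\<forall>\<alpha>. L \<alpha> > 0 \<and> eventually (\<lambda>z. norm (column \<alpha> (partial_jacobian g z) -
      column \<alpha> (partial_jacobian g (0, snd z))) \<le> L \<alpha> * \<bar>fst z\<bar>) (nhds (0, u0))"
    by (rule exE)
  then have L: "L \<alpha> > 0" "eventually (\<lambda>z. norm (column \<alpha> (partial_jacobian g z) -
      column \<alpha> (partial_jacobian g (0, snd z))) \<le> L \<alpha> * \<bar>fst z\<bar>) (nhds (0, u0))" for \<alpha>
    by simp_all
  have "eventually (\<lambda>z. \<forall>\<alpha>.
      norm (column \<alpha> (partial_jacobian g z) - column \<alpha> (partial_jacobian g (0, snd z)))
      \<le> L \<alpha> * \<bar>fst z\<bar>) (nhds (0, u0))"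
    using L(2) by (rule eventually_all_finite)
  then have "eventually (\<lambda>z. norm (partial_jacobian g z - partial_jacobian g (0, snd z)) \<le>
      (CARD('n) * (\<Sum>\<alpha>\<in>UNIV. L \<alpha>)) * \<bar>fst z\<bar>) (nhds (0, u0))"
  proof eventually_elim
    case (elim z)
    let ?A = "partial_jacobian g z" and ?B = "partial_jacobian g (0, snd z)"
    have "column \<alpha> (?A - ?B) = column \<alpha> ?A - column \<alpha> ?B" for \<alpha>
      by (simp add: column_def vec_eq_iff)
    then have "norm (?A - ?B) \<le> CARD('n) * (\<Sum>\<alpha>\<in>UNIV. norm (column \<alpha> ?A - column \<alpha> ?B))"
      using norm_matrix_le_columns[of "?A - ?B"] by simp
    also have "\<dots> \<le> CARD('n) * (\<Sum>\<alpha>\<in>UNIV. L \<alpha> * \<bar>fst z\<bar>)"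
      using elim by (intro mult_left_mono sum_mono) auto
    also have "\<dots> = (CARD('n) * (\<Sum>\<alpha>\<in>UNIV. L \<alpha>)) * \<bar>fst z\<bar>"
      by (simp add: sum_distrib_right)
    finally show ?case .
  qed
  moreover have "CARD('n) * (\<Sum>\<alpha>\<in>UNIV. L \<alpha>) > 0"
    using L(1) by (simp add: sum_pos)
  ultimately show ?thesis using that by blast
qed

lemma tendsto_partial_jacobian:
  assumes "smooth_on S g" "z \<in> S"
  shows "(partial_jacobian g \<longlongrightarrow> partial_jacobian g z) (nhds z)"
  unfolding partial_jacobian_def matrix_def
  by (intro tendsto_intros smooth_on_tendsto[OF smooth_on_frechet_derivative[OF assms(1)] assms(2)])

lemma jacobian_slice:
  assumes "g differentiable (at (t, u))"
  shows "((\<lambda>u. g (t, u)) has_derivative (*v) (partial_jacobian g (t, u))) (at u)"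
proof -
  have "(g has_derivative frechet_derivative g (at (t, u))) (at (t, u))"
    using assms frechet_derivative_works by blast
  moreover have "(Pair t has_derivative Pair 0) (at u)"
    by (auto intro!: derivative_eq_intros)
  ultimately have d: "((\<lambda>u. g (t, u)) has_derivative (\<lambda>h. frechet_derivative g (at (t, u)) (0, h))) (at u)"
    using diff_chain_at[of "Pair t" "Pair 0" u g] by (simp add: comp_def)
  then show ?thesis
    using d matrix_vector_mul(2)[OF has_derivative_linear[OF d]] by (simp add: partial_jacobian_def)
qed

section \<open>The functional along a variation and the Euler-Lagrange equations\<close>

text \<open>Along a solution the scalar product excluded from being zero by the domain is the
  squared norm of the tensor. Being nonnegative as well, it is positive.\<close>

lemma tensor_form_differential_pos:
  assumes M: "riemannian_manifold M" and N: "riemannian_manifold N" and T: "tensor_field M N T"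
    and f: "f \<in> LT_domain M N T" and charts: "C \<in> atlas M" "D \<in> atlas N"
    and a: "a \<in> chart_dom C" "f a \<in> chart_dom D"
    and sol: "differential f C D a = T C D a (f a)"
  shows "tensor_form (matrix_inv (metric M C a)) (metric N D (f a)) (T C D a (f a)) (T C D a (f a)) > 0"
proof -
  have "tensor_form (matrix_inv (metric M C a)) (metric N D (f a)) (T C D a (f a)) (T C D a (f a)) \<ge> 0"
    using a charts by (intro tensor_form_nonneg posdef_matrix_inv posdef_metric[OF M] posdef_metric[OF N])
  then show ?thesis
    using tensor_form_differential_nonzero[OF M N T f charts a] unfolding sol by simp
qed

text \<open>In fixed coordinates, the Jacobian of the variation and the tensor along it both change
  by at most a constant times \<open>\<bar>t\<bar>\<close> from their values at time
  \<open>0\<close>, where they coincide by the differential equation. Their difference is thus of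
  order \<open>t\<close>, and \<open>tensor_ratio_quadratic\<close> squares it.\<close>

lemma LT_density_variation_bound_local:
  assumes M: "riemannian_manifold M" and N: "riemannian_manifold N" and T: "tensor_field M N T"
    and f: "f \<in> LT_domain M N T"
    and sol: "\<And>C D a. C \<in> atlas M \<Longrightarrow> D \<in> atlas N \<Longrightarrow> a \<in> chart_dom C \<Longrightarrow> f a \<in> chart_dom D \<Longrightarrow>
      differential f C D a = T C D a (f a)"
    and var: "smooth_variation M N f \<epsilon> F" and dom: "\<And>t. t \<in> {-\<epsilon><..<\<epsilon>} \<Longrightarrow> F t \<in> LT_domain M N T"
    and a: "a \<in> topspace (mtop M)"
  obtains U \<delta> B where "openin (mtop M) U" "a \<in> U" "\<delta> > 0" "B > 0"
    "\<And>t b. \<bar>t\<bar> < \<delta> \<Longrightarrow> b \<in> U \<Longrightarrow> \<bar>LT_density M N T (F t) b - 1\<bar> \<le> B * t\<^sup>2"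
proof -
  have sm: "smooth_map M N f" using f by (simp add: LT_domain_def)
  then have "f a \<in> topspace (mtop N)"
    using a by (auto simp: smooth_map_def continuous_map_def)
  then obtain D where D_atlas: "D \<in> atlas N" and D: "f a \<in> chart_dom D"
    using riemannian_manifold_chart_exists[OF N] by blast
  obtain C where C_atlas: "C \<in> atlas M" and C: "a \<in> chart_dom C"
    using riemannian_manifold_chart_exists[OF M a] by blast
  note charts = C_atlas D_atlas
  note chC = riemannian_manifold_is_chart[OF M charts(1)]
  note chD = riemannian_manifold_is_chart[OF N charts(2)]
  have eps: "\<epsilon> > 0" and F0: "\<And>b. b \<in> topspace (mtop M) \<Longrightarrow> F 0 b = f b"
    and Fcont: "continuous_map (prod_topology (top_of_set {-\<epsilon><..<\<epsilon>}) (mtop M)) (mtop N) (\<lambda>(t, a). F t a)"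
    using var by (auto simp: smooth_variation_def)
  have F0C: "F 0 b = f b" if "b \<in> chart_dom C" for b
    using F0 chart_dom_subset[OF chC] that by blast
  let ?u = "coord C a"
  let ?O = "coord C ` chart_dom C"
  define \<Omega> where "\<Omega> = {(t, u). t \<in> {-\<epsilon><..<\<epsilon>} \<and> u \<in> ?O \<and> F t (chart_inv C u) \<in> chart_dom D}"
  define g where "g = (\<lambda>(t, u). coord D (F t (chart_inv C u)))"
  have g: "smooth_on \<Omega> g"
    using var charts unfolding smooth_variation_def \<Omega>_def g_def by blast
  have openO: "open ?O" using chC by (simp add: is_chart_def)
  \<comment> \<open>The variation may leave the target chart; \<open>\<Omega>\<close> collects the
    parameters for which it does not. That they fill a neighbourhood of \<open>(0, ?u)\<close> rests
    on joint continuity in time and space.\<close>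
  have open\<Omega>: "open \<Omega>"
  proof -
    let ?X = "prod_topology (top_of_set {-\<epsilon><..<\<epsilon>}) (top_of_set ?O)"
    have "continuous_map ?X (mtop M) (chart_inv C \<circ> snd)"
      by (rule continuous_map_compose[OF continuous_map_snd continuous_map_chart_inv[OF chC]])
    then have "continuous_map ?X (prod_topology (top_of_set {-\<epsilon><..<\<epsilon>}) (mtop M)) (\<lambda>z. (fst z, chart_inv C (snd z)))"
      unfolding comp_def by (intro continuous_map_pairedI continuous_map_fst)
    from continuous_map_compose[OF this Fcont]
    have "continuous_map ?X (mtop N) (\<lambda>z. F (fst z) (chart_inv C (snd z)))"
      by (simp add: comp_def)
    then have "openin ?X {z \<in> topspace ?X. F (fst z) (chart_inv C (snd z)) \<in> chart_dom D}"
      using openin_chart_dom[OF N charts(2)] by (rule openin_continuous_map_preimage)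
    also have "{z \<in> topspace ?X. F (fst z) (chart_inv C (snd z)) \<in> chart_dom D} = \<Omega>"
      by (auto simp: \<Omega>_def)
    also have "?X = top_of_set ({-\<epsilon><..<\<epsilon>} \<times> ?O)"
      by (simp add: prod_topology_subtopology_eu)
    finally show ?thesis
      by (rule openin_open_trans) (intro open_Times openO open_greaterThanLessThan)
  qed
  have z0: "(0, ?u) \<in> \<Omega>"
    using eps C D F0C by (simp add: \<Omega>_def chart_inv_coord[OF chC])
  have gz0: "g (0, ?u) = coord D (f a)"
    using C F0C by (simp add: g_def chart_inv_coord[OF chC])
  let ?F = "nhds (0 :: real, ?u)"
  have ev\<Omega>: "eventually (\<lambda>z. z \<in> \<Omega> \<and> (0, snd z) \<in> \<Omega>) ?F"
  proof -
    have "((\<lambda>z. (0, snd z)) \<longlongrightarrow> (0, snd (0::real, ?u))) ?F"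
      by (intro tendsto_intros filterlim_ident)
    then have "eventually (\<lambda>z. (0, snd z) \<in> \<Omega>) ?F"
      using open\<Omega> z0 topological_tendstoD by fastforce
    moreover have "eventually (\<lambda>z. z \<in> \<Omega>) ?F"
      using open\<Omega> z0 by (rule eventually_nhds_in_open)
    ultimately show ?thesis by eventually_elim simp
  qed
  \<comment> \<open>\<open>h\<close> is kept general because \<open>F 0\<close> is known to agree
    with \<open>f\<close> only on the manifold. The case \<open>h = f\<close> at time
    \<open>0\<close> gives access to the differential equation, the case \<open>h = F t\<close> to
    the density.\<close>
  have diff_slice: "differential h C D (chart_inv C u) = partial_jacobian g (t, u)"
    if tu: "(t, u) \<in> \<Omega>" and h: "\<And>b. b \<in> chart_dom C \<Longrightarrow> h b = F t b" for h t u
  proof -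
    have u: "u \<in> ?O" using tu by (simp add: \<Omega>_def)
    have "((\<lambda>u. g (t, u)) has_derivative (*v) (partial_jacobian g (t, u))) (at u)"
      using smooth_on_differentiable[OF g tu] by (rule jacobian_slice)
    then have "(coord D \<circ> h \<circ> chart_inv C has_derivative (*v) (partial_jacobian g (t, u))) (at u)"
      by (rule has_derivative_transform_within_open[OF _ openO u])
        (auto simp: g_def h chart_inv_coord[OF chC])
    moreover have "coord C (chart_inv C u) = u" using u by (rule f_inv_into_f)
    ultimately show ?thesis
      by (simp add: differential_def jacobian_eqI)
  qed
  define \<tau> where "\<tau> z = T C D (chart_inv C (snd z)) (chart_inv D (g z))" for z
  have \<tau>: "\<tau> (t, u) = T C D (chart_inv C u) (F t (chart_inv C u))" if "(t, u) \<in> \<Omega>" for t u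
    using that by (simp add: \<tau>_def g_def \<Omega>_def chart_inv_coord[OF chD])
  have P0: "partial_jacobian g (0, u) = \<tau> (0, u)" if "(0, u) \<in> \<Omega>" for u
  proof -
    have u: "chart_inv C u \<in> chart_dom C" "F 0 (chart_inv C u) \<in> chart_dom D"
      using that by (auto simp: \<Omega>_def intro: inv_into_into)
    have "partial_jacobian g (0, u) = differential f C D (chart_inv C u)"
      by (rule diff_slice[OF that, symmetric]) (simp add: F0C)
    also have "\<dots> = T C D (chart_inv C u) (f (chart_inv C u))"
      using u by (intro sol charts) (auto simp: F0C)
    finally show ?thesis using \<tau>[OF that] u by (simp add: F0C)
  qed
  obtain Lp where Lp: "Lp > 0"
    "eventually (\<lambda>z. norm (partial_jacobian g z - partial_jacobian g (0, snd z)) \<le> Lp * \<bar>fst z\<bar>) ?F"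
    using partial_jacobian_lipschitz_fst[OF open\<Omega> g z0] by blast
  obtain Lg where Lg: "Lg > 0" "eventually (\<lambda>z. norm (g z - g (0, snd z)) \<le> Lg * \<bar>fst z\<bar>) ?F"
    using smooth_on_lipschitz_fst[OF open\<Omega> g z0] by blast
  have openD: "open (coord D ` chart_dom D)" using chD by (simp add: is_chart_def)
  have fst_t: "(fst \<longlongrightarrow> 0) ?F" and snd_t: "(snd \<longlongrightarrow> ?u) ?F"
    using tendsto_fst[OF filterlim_ident, of "(0, ?u)"] tendsto_snd[OF filterlim_ident, of "(0, ?u)"] by auto
  have g_t: "(g \<longlongrightarrow> coord D (f a)) ?F"
    using smooth_on_tendsto[OF g z0] gz0 by simp
  have "((\<lambda>z. (0, snd z)) \<longlongrightarrow> (0, ?u)) ?F"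
    by (intro tendsto_intros snd_t)
  then have g0_t: "((\<lambda>z. g (0, snd z)) \<longlongrightarrow> coord D (f a)) ?F"
    using smooth_on_tendsto_compose[OF g z0] gz0 by simp
  let ?T = "\<lambda>(u, v). T C D (chart_inv C u) (chart_inv D v)"
  have "(?u, coord D (f a)) \<in> ?O \<times> coord D ` chart_dom D" using C D by simp
  then obtain r Lt where r: "r > 0" and Lt: "Lt > 0"
    "\<And>y z. y \<in> ball (?u, coord D (f a)) r \<Longrightarrow> z \<in> ball (?u, coord D (f a)) r \<Longrightarrow>
      norm (?T y - ?T z) \<le> Lt * norm (y - z)"
    using smooth_on_lipschitz_ball[OF open_Times[OF openO openD] smooth_on_tensor_field[OF T charts]] by metis
  have ball_ev: "eventually (\<lambda>z. (snd z, k z) \<in> ball (?u, coord D (f a)) r) ?F"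
    if "(k \<longlongrightarrow> coord D (f a)) ?F" for k
    by (rule topological_tendstoD[OF tendsto_Pair[OF snd_t that]]) (use r in auto)
  \<comment> \<open>Both values of the tensor are taken at the same source coordinate, so only the
    displacement in the target counts and the Lipschitz constants multiply.\<close>
  have \<tau>L: "eventually (\<lambda>z. norm (\<tau> z - \<tau> (0, snd z)) \<le> Lt * Lg * \<bar>fst z\<bar>) ?F"
    using ball_ev[OF g_t] ball_ev[OF g0_t] Lg(2)
  proof eventually_elim
    case (elim z)
    have "norm (\<tau> z - \<tau> (0, snd z)) \<le> Lt * norm ((snd z, g z) - (snd z, g (0, snd z)))"
      using Lt(2)[OF elim(1,2)] by (simp add: \<tau>_def)
    also have "\<dots> = Lt * norm (g z - g (0, snd z))" by (simp add: norm_Pair)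
    also have "\<dots> \<le> Lt * (Lg * \<bar>fst z\<bar>)" using elim(3) Lt(1) by (intro mult_left_mono) auto
    finally show ?case by simp
  qed
  define L where "L = Lp + Lt * Lg"
  have "L > 0" using Lp(1) Lt(1) Lg(1) by (simp add: L_def add_pos_pos)
  have wL: "eventually (\<lambda>z. norm (partial_jacobian g z - \<tau> z) \<le> L * \<bar>fst z\<bar>) ?F"
    using ev\<Omega> Lp(2) \<tau>L
  proof eventually_elim
    case (elim z)
    then have "partial_jacobian g z - \<tau> z =
        (partial_jacobian g z - partial_jacobian g (0, snd z)) - (\<tau> z - \<tau> (0, snd z))"
      by (simp add: P0)
    then have "norm (partial_jacobian g z - \<tau> z) \<le>
        norm (partial_jacobian g z - partial_jacobian g (0, snd z)) + norm (\<tau> z - \<tau> (0, snd z))"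
      by (metis norm_triangle_ineq4)
    with elim show ?case by (simp add: L_def distrib_right)
  qed
  let ?K = "\<lambda>z. matrix_inv (metric M C (chart_inv C (snd z)))" and ?H = "\<lambda>z. metric N D (chart_inv D (g z))"
  have P_t: "(partial_jacobian g \<longlongrightarrow> T C D a (f a)) ?F"
    using tendsto_partial_jacobian[OF g z0] P0[OF z0] \<tau>[OF z0] C by (simp add: chart_inv_coord[OF chC] F0C)
  have \<tau>_t: "(\<tau> \<longlongrightarrow> T C D a (f a)) ?F"
    unfolding \<tau>_def by (rule tendsto_tensor_field[OF M N T charts C D snd_t g_t])
  have "eventually (\<lambda>z. posdef (?K z) \<and> posdef (?H z)) ?F"
    using eventually_posdef_metric[OF M charts(1) C snd_t] eventually_posdef_metric[OF N charts(2) D g_t]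
    by eventually_elim (simp add: posdef_matrix_inv)
  then obtain B where B: "B > 0" "eventually (\<lambda>z. 1 \<le> tensor_ratio (?K z) (?H z) (partial_jacobian g z) (\<tau> z) \<and>
      tensor_ratio (?K z) (?H z) (partial_jacobian g z) (\<tau> z) \<le> 1 + B * (norm (partial_jacobian g z - \<tau> z))\<^sup>2) ?F"
    using tensor_ratio_quadratic[OF tendsto_inverse_metric[OF M charts(1) C snd_t]
        tendsto_metric[OF N charts(2) D g_t] P_t \<tau>_t _
        tensor_form_differential_pos[OF M N T f charts C D sol[OF charts C D]]] by blast
  have "eventually (\<lambda>z. \<bar>LT_density M N T (F (fst z)) (chart_inv C (snd z)) - 1\<bar> \<le> B * L\<^sup>2 * (fst z)\<^sup>2) ?F"
    using ev\<Omega> B(2) wL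
  proof eventually_elim
    case (elim z)
    obtain t u where z: "z = (t, u)" by fastforce
    have tu: "(t, u) \<in> \<Omega>" using elim z by simp
    then have t: "t \<in> {-\<epsilon><..<\<epsilon>}" and u: "u \<in> ?O" and v: "F t (chart_inv C u) \<in> chart_dom D"
      by (auto simp: \<Omega>_def)
    have "smooth_map M N (F t)" using dom[OF t] by (simp add: LT_domain_def)
    from LT_density_in_charts[OF M N T this charts inv_into_into[OF u] v]
    have "LT_density M N T (F t) (chart_inv C u) = tensor_ratio (?K z) (?H z) (partial_jacobian g z) (\<tau> z)"
      using diff_slice[OF tu] \<tau>[OF tu] v by (simp add: z g_def chart_inv_coord[OF chD])
    then have "\<bar>LT_density M N T (F t) (chart_inv C u) - 1\<bar> \<le> B * (norm (partial_jacobian g z - \<tau> z))\<^sup>2"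
      using elim by simp
    also have "\<dots> \<le> B * (L * \<bar>fst z\<bar>)\<^sup>2"
      using elim B(1) by (intro mult_left_mono power_mono) auto
    finally show ?case by (simp add: z power_mult_distrib mult.assoc)
  qed
  \<comment> \<open>A neighbourhood of \<open>(0, ?u)\<close> contains a product of neighbourhoods.
    Splitting it yields one time bound \<open>\<delta>\<close> for all points of \<open>U\<close>,
    the uniformity on which the compactness argument relies.\<close>
  then obtain Q R where Q: "eventually Q (nhds 0)" and R: "eventually R (nhds ?u)"
    and QR: "\<And>t u. Q t \<Longrightarrow> R u \<Longrightarrow> \<bar>LT_density M N T (F t) (chart_inv C u) - 1\<bar> \<le> B * L\<^sup>2 * t\<^sup>2"
    unfolding nhds_prod eventually_prod_filter by auto
  obtain \<delta> where \<delta>: "\<delta> > 0" "\<And>t. \<bar>t\<bar> < \<delta> \<Longrightarrow> Q t"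
    using Q by (auto simp: eventually_nhds_metric)
  obtain U where U: "openin (mtop M) U" "a \<in> U" "U \<subseteq> chart_dom C" "\<And>b. b \<in> U \<Longrightarrow> R (coord C b)"
    using eventually_nhds_coord_imp_open[OF chC C R] by blast
  show ?thesis
  proof (rule that[OF U(1,2) \<delta>(1)])
    show "B * L\<^sup>2 > 0" using B(1) \<open>L > 0\<close> by simp
    show "\<bar>LT_density M N T (F t) b - 1\<bar> \<le> B * L\<^sup>2 * t\<^sup>2" if "\<bar>t\<bar> < \<delta>" "b \<in> U" for t b
      using QR[OF \<delta>(2)[OF that(1)] U(4)[OF that(2)]] chart_inv_coord[OF chC, of b] U(3) that(2) by auto
  qed
qed

lemma LT_density_variation_bound:
  assumes M: "riemannian_manifold M" and N: "riemannian_manifold N" and T: "tensor_field M N T"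
    and f: "f \<in> LT_domain M N T"
    and sol: "\<And>C D a. C \<in> atlas M \<Longrightarrow> D \<in> atlas N \<Longrightarrow> a \<in> chart_dom C \<Longrightarrow> f a \<in> chart_dom D \<Longrightarrow>
      differential f C D a = T C D a (f a)"
    and var: "smooth_variation M N f \<epsilon> F" and dom: "\<And>t. t \<in> {-\<epsilon><..<\<epsilon>} \<Longrightarrow> F t \<in> LT_domain M N T"
    and comp: "compact_space (mtop M)"
  obtains \<delta> B where "\<delta> > 0" "B > 0"
    "\<And>t b. \<bar>t\<bar> < \<delta> \<Longrightarrow> b \<in> topspace (mtop M) \<Longrightarrow> \<bar>LT_density M N T (F t) b - 1\<bar> \<le> B * t\<^sup>2"
proof -
  let ?X = "topspace (mtop M)"
  define good where "good a U \<delta> B \<longleftrightarrow> openin (mtop M) U \<and> a \<in> U \<and> \<delta> > 0 \<and> B > 0 \<and>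
     (\<forall>t b. \<bar>t\<bar> < \<delta> \<longrightarrow> b \<in> U \<longrightarrow> \<bar>LT_density M N T (F t) b - 1\<bar> \<le> B * t\<^sup>2)" for a U \<delta> B
  have "\<exists>U \<delta> B. good a U \<delta> B" if "a \<in> ?X" for a
    by (rule LT_density_variation_bound_local[OF M N T f sol var dom that])
      (simp_all add: good_def, blast)
  then obtain U \<delta> B where good: "\<And>a. a \<in> ?X \<Longrightarrow> good a (U a) (\<delta> a) (B a)"
    by metis
  have "openin (mtop M) (U a) \<and> a \<in> U a" if "a \<in> ?X" for a
    using good[OF that] by (simp add: good_def)
  then obtain K where K: "finite K" "K \<subseteq> ?X" "?X \<subseteq> (\<Union>a\<in>K. U a)"
    using compact_space_finite_subcover[OF comp, of U] by blast
  \<comment> \<open>Minimum and sum over the finite subcover; the \<open>1\<close> in each keeps it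
    well defined and positive even if \<open>K\<close> is empty.\<close>
  define d where "d = Min (insert 1 (\<delta> ` K))"
  define b where "b = 1 + (\<Sum>a\<in>K. B a)"
  have pos: "\<delta> a > 0" "B a > 0" if "a \<in> K" for a
    using good[of a] K(2) that by (auto simp: good_def)
  show ?thesis
  proof
    show "d > 0" using K(1) pos by (simp add: d_def)
    show "b > 0" using pos by (simp add: b_def add_pos_nonneg sum_nonneg less_imp_le)
    fix t x assume t: "\<bar>t\<bar> < d" and x: "x \<in> ?X"
    then obtain a where a: "a \<in> K" "x \<in> U a" using K(3) by blast
    have "d \<le> \<delta> a" using K(1) a(1) by (simp add: d_def)
    then have "\<bar>LT_density M N T (F t) x - 1\<bar> \<le> B a * t\<^sup>2"
      using good[of a] a t K(2) by (auto simp: good_def)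
    also have "B a \<le> b"
      using member_le_sum[OF a(1), of B] K(1) pos by (simp add: b_def less_imp_le)
    then have "B a * t\<^sup>2 \<le> b * t\<^sup>2" by (intro mult_right_mono) auto
    finally show "\<bar>LT_density M N T (F t) x - 1\<bar> \<le> b * t\<^sup>2" .
  qed
qed

text \<open>Integrated over a space of finite volume, the uniform pointwise bound becomes a bound on
  the functional that is quadratic in \<open>t\<close>.\<close>

lemma critical_point_LT:
  assumes M: "riemannian_manifold M" and N: "riemannian_manifold N" and T: "tensor_field M N T"
    and f: "f \<in> LT_domain M N T"
    and sol: "\<And>C D a. C \<in> atlas M \<Longrightarrow> D \<in> atlas N \<Longrightarrow> a \<in> chart_dom C \<Longrightarrow> f a \<in> chart_dom D \<Longrightarrow>
      differential f C D a = T C D a (f a)"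
    and comp: "compact_space (mtop M)"
  shows "critical_point M N (LT_domain M N T) (LT M N T) f"
  unfolding critical_point_def
proof (intro conjI allI impI f)
  fix \<epsilon> F assume "smooth_variation M N f \<epsilon> F \<and> (\<forall>t\<in>{-\<epsilon><..<\<epsilon>}. F t \<in> LT_domain M N T)"
  then have var: "smooth_variation M N f \<epsilon> F" and dom: "\<And>t. t \<in> {-\<epsilon><..<\<epsilon>} \<Longrightarrow> F t \<in> LT_domain M N T"
    by auto
  have eps: "\<epsilon> > 0" using var by (simp add: smooth_variation_def)
  obtain \<delta> B where \<delta>: "\<delta> > 0" and B: "B > 0"
    "\<And>t b. \<bar>t\<bar> < \<delta> \<Longrightarrow> b \<in> topspace (mtop M) \<Longrightarrow> \<bar>LT_density M N T (F t) b - 1\<bar> \<le> B * t\<^sup>2"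
    using LT_density_variation_bound[OF M N T f sol var dom comp] by blast
  interpret finite_measure "riem_vol M" by (rule finite_measure_riem_vol[OF M comp])
  let ?q = "\<lambda>t. LT_density M N T (F t)" and ?V = "measure (riem_vol M) (space (riem_vol M))"
  have LT: "LT M N T h = 1 / 2 * (\<integral>a. LT_density M N T h a \<partial>riem_vol M)" for h
    by (simp add: LT_def LT_density_def)
  \<comment> \<open>Integrability is required to split the integral of a difference, as the integral
    of a non-integrable function is \<open>0\<close> by convention. A continuous density bounded on
    a space of finite measure is integrable.\<close>
  have int: "integrable (riem_vol M) (?q t)" if "\<bar>t\<bar> < \<delta>" "\<bar>t\<bar> < \<epsilon>" for t
  proof (rule integrable_const_bound)
    have "t \<in> {-\<epsilon><..<\<epsilon>}" using that by auto
    then show "?q t \<in> borel_measurable (riem_vol M)"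
      by (intro continuous_map_measurable_riem_vol continuous_map_LT_density M N T dom)
    show "AE a in riem_vol M. norm (?q t a) \<le> 1 + B * t\<^sup>2"
      using B(2)[OF that(1)] by (intro AE_I2) (fastforce simp: space_riem_vol abs_le_iff)
  qed
  have bound: "\<bar>LT M N T (F t) - LT M N T (F 0)\<bar> \<le> (B * ?V / 2) * (norm (t - 0))\<^sup>2"
    if t: "\<bar>t\<bar> < \<delta>" "\<bar>t\<bar> < \<epsilon>" for t
  proof -
    have "\<bar>\<integral>a. ?q t a - ?q 0 a \<partial>riem_vol M\<bar> \<le> (\<integral>a. \<bar>?q t a - ?q 0 a\<bar> \<partial>riem_vol M)"
      by (rule integral_abs_bound)
    also have "\<dots> \<le> (\<integral>a. B * t\<^sup>2 \<partial>riem_vol M)"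
    proof (rule integral_mono)
      show "integrable (riem_vol M) (\<lambda>a. \<bar>?q t a - ?q 0 a\<bar>)"
        using int[OF t] int[of 0] \<delta> eps by auto
      \<comment> \<open>At time \<open>0\<close> the bound reads
        \<open>\<bar>?q 0 a - 1\<bar> \<le> 0\<close>, so the density is identically
        \<open>1\<close> there.\<close>
      show "\<bar>?q t a - ?q 0 a\<bar> \<le> B * t\<^sup>2" if "a \<in> space (riem_vol M)" for a
        using B(2)[OF t(1), of a] B(2)[of 0 a] \<delta> that by (simp add: space_riem_vol)
    qed simp
    also have "\<dots> = B * t\<^sup>2 * ?V" by simp
    finally have "\<bar>(\<integral>a. ?q t a \<partial>riem_vol M) - (\<integral>a. ?q 0 a \<partial>riem_vol M)\<bar> \<le> B * ?V * t\<^sup>2"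
      using int[OF t] int[of 0] \<delta> eps by (simp add: mult_ac)
    then show ?thesis by (simp add: LT abs_if split: if_splits)
  qed
  have "eventually (\<lambda>t. \<bar>t\<bar> < min \<delta> \<epsilon>) (nhds 0)"
    using \<delta> eps by (auto simp: eventually_nhds_metric intro!: exI[of _ "min \<delta> \<epsilon>"])
  then have "eventually (\<lambda>t. \<bar>LT M N T (F t) - LT M N T (F 0)\<bar> \<le> (B * ?V / 2) * (norm (t - 0))\<^sup>2) (nhds 0)"
    by eventually_elim (rule bound, auto)
  then have "((\<lambda>t. LT M N T (F t)) has_derivative (\<lambda>_. 0)) (at 0)"
    by (rule has_derivative_zero_of_quadratic)
  then show "((\<lambda>t. LT M N T (F t)) has_real_derivative 0) (at 0)"
    by (simp add: has_field_derivative_def mult_zero_left[abs_def])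
qed

text \<open>Both derivatives in the Euler-Lagrange equations are instances. For the jet variable
  \<open>\<tau>\<close> is fixed and \<open>p\<close> moves; for the target variable
  \<open>p\<close> is fixed while \<open>\<tau>\<close> and \<open>H\<close> move. The volume factor
  depends on the point of \<open>M\<close> alone and goes into the constant
  \<open>c\<close>.\<close>

lemma tensor_ratio_has_derivative_zero:
  fixes z0 :: "'z::real_normed_vector"
  assumes "(K \<longlongrightarrow> K0) (nhds z0)" "(H \<longlongrightarrow> H0) (nhds z0)" "(p \<longlongrightarrow> \<tau>0) (nhds z0)" "(\<tau> \<longlongrightarrow> \<tau>0) (nhds z0)"
    and "eventually (\<lambda>z. posdef (K z) \<and> posdef (H z)) (nhds z0)"
    and "tensor_form K0 H0 \<tau>0 \<tau>0 > 0"
    and L: "eventually (\<lambda>z. norm (p z - \<tau> z) \<le> L * norm (z - z0)) (nhds z0)"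
  shows "((\<lambda>z. c * tensor_ratio (K z) (H z) (p z) (\<tau> z)) has_derivative (\<lambda>_. 0)) (at z0)"
proof -
  obtain B where B: "B > 0" "eventually (\<lambda>z. 1 \<le> tensor_ratio (K z) (H z) (p z) (\<tau> z) \<and>
      tensor_ratio (K z) (H z) (p z) (\<tau> z) \<le> 1 + B * (norm (p z - \<tau> z))\<^sup>2) (nhds z0)"
    using tensor_ratio_quadratic[OF assms(1-6)] by blast
  \<comment> \<open>\<open>nhds\<close> includes the point itself, where the Lipschitz bound leaves
    no room for a difference.\<close>
  have "p z0 = \<tau> z0"
    using eventually_nhds_x_imp_x[OF L] by simp
  then have z0: "tensor_ratio (K z0) (H z0) (p z0) (\<tau> z0) = 1"
    using eventually_nhds_x_imp_x[OF B(2)] by simp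
  have "eventually (\<lambda>z. \<bar>c * tensor_ratio (K z) (H z) (p z) (\<tau> z) - c * tensor_ratio (K z0) (H z0) (p z0) (\<tau> z0)\<bar>
      \<le> (\<bar>c\<bar> * B * L\<^sup>2) * (norm (z - z0))\<^sup>2) (nhds z0)"
    using B(2) L
  proof eventually_elim
    case (elim z)
    have "\<bar>c * tensor_ratio (K z) (H z) (p z) (\<tau> z) - c * tensor_ratio (K z0) (H z0) (p z0) (\<tau> z0)\<bar> =
        \<bar>c\<bar> * (tensor_ratio (K z) (H z) (p z) (\<tau> z) - 1)"
      using elim by (simp add: z0 abs_mult flip: right_diff_distrib[of c _ 1, simplified])
    also have "\<dots> \<le> \<bar>c\<bar> * (B * (norm (p z - \<tau> z))\<^sup>2)"
      using elim by (intro mult_left_mono) auto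
    also have "\<dots> \<le> \<bar>c\<bar> * (B * (L * norm (z - z0))\<^sup>2)"
      using elim B(1) by (intro mult_left_mono power_mono) auto
    finally show ?case by (simp add: power_mult_distrib mult.assoc)
  qed
  then show ?thesis by (rule has_derivative_zero_of_quadratic)
qed

lemma LT_lagrangian_eq:
  "LT_lagrangian M N T C D u v p = 1 / 2 * sqrt (det (metric M C (chart_inv C u))) *
    tensor_ratio (matrix_inv (metric M C (chart_inv C u))) (metric N D (chart_inv D v)) p
      (T C D (chart_inv C u) (chart_inv D v))"
  by (simp add: LT_lagrangian_def Let_def tensor_inner_eq_tensor_form tensor_ratio_def)

section \<open>The Euler-Lagrange equations along a solution\<close>

context
  fixes M :: "('a, 'm::finite) riem_mfd" and N :: "('b, 'n::finite) riem_mfd"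
    and T :: "('a, 'm) chart \<Rightarrow> ('b, 'n) chart \<Rightarrow> 'a \<Rightarrow> 'b \<Rightarrow> real ^ 'm ^ 'n" and f C D a
  assumes M: "riemannian_manifold M" and N: "riemannian_manifold N" and T: "tensor_field M N T"
    and f: "f \<in> LT_domain M N T" and charts: "C \<in> atlas M" "D \<in> atlas N"
    and a: "a \<in> chart_dom C" "f a \<in> chart_dom D"
    and sol: "differential f C D a = T C D a (f a)"
begin

text \<open>Here \<open>p\<close> is the identity and the other matrices are constant. The distance
  from \<open>p\<close> to \<open>\<tau>\<close> is then the distance to the base point, with
  Lipschitz constant \<open>1\<close>.\<close>

lemma LT_lagrangian_jet_derivative_zero:
  "(LT_lagrangian M N T C D (coord C a) (coord D (f a)) has_derivative (\<lambda>_. 0)) (at (differential f C D a))"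
proof -
  note ch = riemannian_manifold_is_chart[OF M charts(1)] riemannian_manifold_is_chart[OF N charts(2)]
  show ?thesis
    unfolding LT_lagrangian_eq chart_inv_coord[OF ch(1) a(1)] chart_inv_coord[OF ch(2) a(2)] sol
    by (rule tensor_ratio_has_derivative_zero[OF tendsto_const tendsto_const filterlim_ident tendsto_const
          _ tensor_form_differential_pos[OF M N T f charts a sol], of 1])
      (use posdef_metric[OF M charts(1) a(1)] posdef_metric[OF N charts(2) a(2)] in
        \<open>auto simp: posdef_matrix_inv\<close>)
qed

text \<open>Moving the target point changes the metric of \<open>N\<close> as well as the tensor.
  For the metric, continuity and definiteness are enough, because the excess of the ratio over
  \<open>1\<close> is measured by \<open>p - \<tau>\<close>; for the tensor, smoothness supplies a
  Lipschitz bound.\<close>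

lemma LT_lagrangian_target_derivative_zero:
  "((\<lambda>v. LT_lagrangian M N T C D (coord C a) v (differential f C D a)) has_derivative (\<lambda>_. 0)) (at (coord D (f a)))"
proof -
  note ch = riemannian_manifold_is_chart[OF M charts(1)] riemannian_manifold_is_chart[OF N charts(2)]
  let ?T = "\<lambda>(u, v). T C D (chart_inv C u) (chart_inv D v)" and ?z = "(coord C a, coord D (f a))"
  have op: "open (coord C ` chart_dom C \<times> coord D ` chart_dom D)"
    using ch by (intro open_Times) (auto simp: is_chart_def)
  have z: "?z \<in> coord C ` chart_dom C \<times> coord D ` chart_dom D" using a by simp
  obtain r L where r: "r > 0" and L: "L > 0"
    "\<And>y z. y \<in> ball ?z r \<Longrightarrow> z \<in> ball ?z r \<Longrightarrow> norm (?T y - ?T z) \<le> L * norm (y - z)"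
    using smooth_on_lipschitz_ball[OF op smooth_on_tensor_field[OF T charts] z] by metis
  have "eventually (\<lambda>v. v \<in> ball (coord D (f a)) r) (nhds (coord D (f a)))"
    using r by (intro eventually_nhds_in_open) auto
  then have lip: "eventually (\<lambda>v. norm (T C D a (f a) - T C D a (chart_inv D v)) \<le> L * norm (v - coord D (f a)))
      (nhds (coord D (f a)))"
  proof eventually_elim
    case (elim v)
    then have "norm (?T ?z - ?T (coord C a, v)) \<le> L * norm (?z - (coord C a, v))"
      using r by (intro L(2)) (auto simp: dist_Pair_Pair)
    then show ?case
      using a by (simp add: norm_Pair norm_minus_commute chart_inv_coord[OF ch(1)] chart_inv_coord[OF ch(2)])
  qed
  have pd: "eventually (\<lambda>v. posdef (matrix_inv (metric M C a)) \<and> posdef (metric N D (chart_inv D v))) (nhds (coord D (f a)))"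
    using eventually_posdef_metric[OF N charts(2) a(2) filterlim_ident]
    by eventually_elim (use posdef_metric[OF M charts(1) a(1)] posdef_matrix_inv in auto)
  have "((\<lambda>v. T C D (chart_inv C (coord C a)) (chart_inv D v)) \<longlongrightarrow> T C D a (f a)) (nhds (coord D (f a)))"
    by (rule tendsto_tensor_field[OF M N T charts a tendsto_const filterlim_ident])
  then have T_t: "((\<lambda>v. T C D a (chart_inv D v)) \<longlongrightarrow> T C D a (f a)) (nhds (coord D (f a)))"
    by (simp add: chart_inv_coord[OF ch(1) a(1)])
  show ?thesis
    unfolding LT_lagrangian_eq chart_inv_coord[OF ch(1) a(1)] sol
    by (rule tensor_ratio_has_derivative_zero[OF tendsto_const
          tendsto_metric[OF N charts(2) a(2) filterlim_ident] tendsto_const T_t pd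
          tensor_form_differential_pos[OF M N T f charts a sol] lip])
qed

end

text \<open>The derivative in the jet variable vanishes at every coordinate point of the open set
  where \<open>f\<close> stays in the target chart, not just at the one considered. The functions
  differentiated on the left-hand side are therefore locally zero, and so are their derivatives; the
  right-hand side vanishes separately.\<close>

lemma euler_lagrange_LT:
  assumes M: "riemannian_manifold M" and N: "riemannian_manifold N" and T: "tensor_field M N T"
    and f: "f \<in> LT_domain M N T"
    and sol: "\<And>C D a. C \<in> atlas M \<Longrightarrow> D \<in> atlas N \<Longrightarrow> a \<in> chart_dom C \<Longrightarrow> f a \<in> chart_dom D \<Longrightarrow>
      differential f C D a = T C D a (f a)"
  shows "euler_lagrange M N (LT_lagrangian M N T) f"
  unfolding euler_lagrange_def Let_def
proof (intro ballI impI allI)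
  fix C D a i assume charts: "C \<in> atlas M" "D \<in> atlas N" and a: "a \<in> chart_dom C" "f a \<in> chart_dom D"
  let ?g = "coord D \<circ> f \<circ> chart_inv C"
  let ?dp = "\<lambda>\<alpha> u. frechet_derivative (LT_lagrangian M N T C D u (?g u)) (at (jacobian ?g (at u))) (axis i (axis \<alpha> 1))"
  note ch = riemannian_manifold_is_chart[OF M charts(1)]
  have sm: "smooth_map M N f" using f by (simp add: LT_domain_def)
  let ?W = "{b \<in> chart_dom C. f b \<in> chart_dom D}"
  have op: "open (coord C ` ?W)"
    by (rule chart_open_image[OF ch openin_smooth_map_preimage[OF M N sm charts]]) auto
  have dp0: "?dp \<alpha> u = 0" if u: "u \<in> coord C ` ?W" for \<alpha> u
  proof -
    obtain b where b: "b \<in> chart_dom C" "f b \<in> chart_dom D" "u = coord C b" using u by auto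
    have "?g u = coord D (f b)" "jacobian ?g (at u) = differential f C D b"
      using b by (simp_all add: differential_def chart_inv_coord[OF ch])
    then show ?thesis
      using LT_lagrangian_jet_derivative_zero[OF M N T f charts b(1,2) sol[OF charts b(1,2)]] b(3)
      by (simp flip: frechet_derivative_at)
  qed
  have "(?dp \<alpha> has_derivative (\<lambda>_. 0)) (at (coord C a))" for \<alpha>
    by (rule has_derivative_transform_within_open[OF has_derivative_const[of 0] op])
      (use a dp0 in auto)
  then have "frechet_derivative (?dp \<alpha>) (at (coord C a)) = (\<lambda>_. 0)" for \<alpha>
    by (rule frechet_derivative_at[symmetric])
  moreover have "((\<lambda>v. LT_lagrangian M N T C D (coord C a) v (jacobian ?g (at (coord C a)))) has_derivative (\<lambda>_. 0))
      (at (?g (coord C a)))"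
    using LT_lagrangian_target_derivative_zero[OF M N T f charts a sol[OF charts a]] a
    by (simp add: differential_def chart_inv_coord[OF ch])
  then have "frechet_derivative (\<lambda>v. LT_lagrangian M N T C D (coord C a) v (jacobian ?g (at (coord C a))))
      (at (?g (coord C a))) = (\<lambda>_. 0)"
    by (rule frechet_derivative_at[symmetric])
  ultimately show "(\<Sum>\<alpha>\<in>UNIV. frechet_derivative (?dp \<alpha>) (at (coord C a)) (axis \<alpha> 1)) =
      frechet_derivative (\<lambda>v. LT_lagrangian M N T C D (coord C a) v (jacobian ?g (at (coord C a))))
        (at (?g (coord C a))) (axis i 1)"
    by simp
qed

theorem mainTheorem1:
  fixes M :: "('a, 'm::finite) riem_mfd"
    and N :: "('b, 'n::finite) riem_mfd"
    and T :: "('a, 'm) chart \<Rightarrow> ('b, 'n) chart \<Rightarrow> 'a \<Rightarrow> 'b \<Rightarrow> real ^ 'm ^ 'n"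
    and f :: "'a \<Rightarrow> 'b"
  assumes "riemannian_manifold M"
    and "riemannian_manifold N"
    and "connected_space (mtop M)"
    and "compact_space (mtop M)"
    and "orientable (mtop M) (atlas M)"
    and "tensor_field M N T"
    and "f \<in> LT_domain M N T"
    and "\<forall>C \<in> atlas M. \<forall>D \<in> atlas N. \<forall>a \<in> chart_dom C. f a \<in> chart_dom D \<longrightarrow>
           (\<forall>i \<alpha>. differential f C D a $ i $ \<alpha> = along T f C D a $ i $ \<alpha>)"
  shows "extremal_LT M N T f"
proof -
  have sol: "differential f C D a = T C D a (f a)"
    if "C \<in> atlas M" "D \<in> atlas N" "a \<in> chart_dom C" "f a \<in> chart_dom D" for C D a
    using assms(8) that by (simp add: vec_eq_iff along_def)
  show ?thesis
    unfolding extremal_LT_def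
    using critical_point_LT[OF assms(1,2,6,7) sol assms(4)] euler_lagrange_LT[OF assms(1,2,6,7) sol]
    by blast
qed

end
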